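(* Let $n\ge1$, let $p_t(r,\eta)$ be the subelliptic heat kernel of the sub-Laplacian $L$ on $\mathbb{S}^{4n+3}$ and $h_t(r,\phi)$ the subelliptic heat kernel of the sub-Laplacian $\mathcal{L}$ on $\mathbb{CP}^{2n+1}$. For $t>0$, $r\in[0,\frac{\pi}{2})$, $\phi\in[0,\frac{\pi}{2}]$, $$h_t(r,\phi)=\frac{1}{2\pi}\int_0^\pi p_t\big(r,\arccos(\cos\phi\cos\theta)\big)\,d\theta.$$
   Context: $\mathbb{S}^{4n+3}=\{q\in\mathbb{H}^{n+1}:\|q\|=1\}$ ($\mathbb{H}$ the quaternions) with its round metric. The unit quaternions $\mathbf{SU}(2)$ act isometrically by $g\cdot(q_1,\dots,q_{n+1})=(gq_1,\dots,gq_{n+1})$ with quotient $\mathbb{HP}^n$; the subgroup $\mathbb{S}^1=\{e^{I\theta}\}$ has quotient $\mathbb{CP}^{2n+1}$, which induces the fibration $\mathbf{SU}(2)/\mathbb{S}^1=\mathbb{CP}^1\to\mathbb{CP}^{2n+1}\to\mathbb{HP}^n$ (quotient metrics making the projections Riemannian submersions). $L$ (resp. $\mathcal{L}$) is the lift to $\mathbb{S}^{4n+3}$ (resp. $\mathbb{CP}^{2n+1}$) of the Laplace–Beltrami operator of $\mathbb{HP}^n$. $p_t$ is the kernel of $e^{tL}$ from the north pole $(0,\dots,0,1)$ with respect to the Riemannian volume; it depends only on $(r,\eta)\in[0,\pi/2)\times[0,\pi]$ given by $|q_{n+1}|=\cos r$, $\mathrm{Re}(q_{n+1})=\cos r\cos\eta$.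 On such functions the volume reads $\frac{8\pi^{2n+1}}{\Gamma(2n)}(\sin r)^{4n-1}(\cos r)^3(\sin\eta)^2\,dr\,d\eta$. On $\mathbb{CP}^{2n+1}$, $\phi\in[0,\pi/2]$ is the distance on $\mathbb{CP}^1$ from the class of the identity to the class of $q_{n+1}/|q_{n+1}|$ (writing $q_{n+1}/|q_{n+1}|=a+bJ$ with $a,b\in\mathrm{span}_{\mathbb{R}}(1,I)$, $|a|=\cos\phi$). $h_t(r,\phi)$ is the heat kernel of $e^{t\mathcal{L}}$ issued from the image of the north pole; it depends only on $(r,\phi)$ and is taken with respect to the multiple of the Riemannian measure which on functions of $(r,\phi)$ reads $\frac{8\pi^{2n+2}}{\Gamma(2n)}(\sin r)^{4n-1}(\cos r)^3\sin2\phi\,dr\,d\phi$. *)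

theory Defs
  imports "HOL-Analysis.Analysis"
begin

section \<open>Quaternions and the quaternionic Hopf action\<close>

text \<open>The pair \<open>(a, b)\<close> stands for the quaternion \<open>a + b J\<close> with
  \<open>a, b \<in> span(1, I)\<close>, where \<open>span(1, I)\<close> is identified with the complex numbers. The product
  below is dictated by \<open>J c = cnj c J\<close> and \<open>J J = -1\<close>. The product norm and inner product are the
  quaternionic ones, and the real part of the quaternion is \<open>Re a\<close>.\<close>

type_synonym quat = "complex \<times> complex"

definition qmult :: "quat \<Rightarrow> quat \<Rightarrow> quat" where
  "qmult p q = (fst p * fst q - snd p * cnj (snd q), fst p * snd q + snd p * cnj (fst q))"

text \<open>\<open>\<H>\<^sup>n\<^sup>+\<^sup>1\<close> with \<open>n = CARD('n) \<ge> 1\<close>; the second component is the last coordinate \<open>q\<^sub>n\<^sub>+\<^sub>1\<close>.\<close>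

type_synonym 'n hvec = "(quat, 'n) vec \<times> quat"

definition qact :: "quat \<Rightarrow> 'n::finite hvec \<Rightarrow> 'n hvec" where
  "qact g q = ((\<chi> i. qmult g (fst q $ i)), qmult g (snd q))"

abbreviation hsphere :: "'n::finite hvec set" where
  "hsphere \<equiv> sphere 0 1"

definition north :: "'n::finite hvec" where
  "north = (0, (1, 0))"

text \<open>Points of \<open>\<complex>P\<^sup>2\<^sup>n\<^sup>+\<^sup>1\<close> are the orbits of the circle \<open>{e\<^sup>I\<^sup>\<theta>}\<close> on the sphere.\<close>

definition cproj :: "'n::finite hvec \<Rightarrow> 'n hvec set" where
  "cproj q = {qact (cis \<theta>, 0) q | \<theta>. True}"

definition CPspace :: "'n::finite hvec set set" where
  "CPspace = cproj ` hsphere"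

definition rep :: "'n::finite hvec set \<Rightarrow> 'n hvec" where
  "rep X = (SOME q. q \<in> X)"


section \<open>Continuous and smooth functions\<close>

text \<open>Only the values on \<open>hsphere\<close>, respectively \<open>CPspace\<close>, matter.\<close>

definition sphere_cont :: "('n::finite hvec \<Rightarrow> real) set" where
  "sphere_cont = {f. continuous_on hsphere f}"

definition CP_cont :: "('n::finite hvec set \<Rightarrow> real) set" where
  "CP_cont = {f. f \<circ> cproj \<in> sphere_cont}"

text \<open>\<open>C\<^sup>k\<close> on an open subset of a finite-dimensional space.\<close>

primrec Ck_on :: "nat \<Rightarrow> 'a::euclidean_space set \<Rightarrow> ('a \<Rightarrow> real) \<Rightarrow> bool" where
  "Ck_on 0 U f \<longleftrightarrow> continuous_on U f"
| "Ck_on (Suc k) U f \<longleftrightarrow>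
     f differentiable_on U \<and> (\<forall>v. Ck_on k U (\<lambda>x. frechet_derivative f (at x) v))"

text \<open>A function on the sphere is smooth iff its extension that is constant along rays,
  \<open>x \<mapsto> f (x / \<parallel>x\<parallel>)\<close>, is smooth off the origin. A function on \<open>\<complex>P\<^sup>2\<^sup>n\<^sup>+\<^sup>1\<close> is smooth iff its pullback
  along the submersion \<open>cproj\<close> is smooth.\<close>

definition sphere_smooth :: "('n::finite hvec \<Rightarrow> real) set" where
  "sphere_smooth = {f. \<forall>k. Ck_on k (- {0}) (\<lambda>x. f (sgn x))}"

definition CP_smooth :: "('n::finite hvec set \<Rightarrow> real) set" where
  "CP_smooth = {f. f \<circ> cproj \<in> sphere_smooth}"


section \<open>The two sub-Laplacians\<close>

text \<open>Tangent vectors at \<open>q\<close> orthogonal to the fibre \<open>SU(2) q\<close>; the tangent space of the fibre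
  consists of the \<open>v q\<close> with \<open>v\<close> an imaginary quaternion.\<close>

definition horizontal :: "'n::finite hvec \<Rightarrow> 'n hvec set" where
  "horizontal q = {e. e \<bullet> q = 0 \<and> (\<forall>v. Re (fst v) = 0 \<longrightarrow> e \<bullet> qact v q = 0)}"

definition horizontal_frame :: "'n::finite hvec \<Rightarrow> 'n hvec set \<Rightarrow> bool" where
  "horizontal_frame q B \<longleftrightarrow>
     pairwise orthogonal B \<and> (\<forall>e\<in>B. norm e = 1) \<and> span B = horizontal q"

definition great_circle :: "'n::finite hvec \<Rightarrow> 'n hvec \<Rightarrow> real \<Rightarrow> 'n hvec" where
  "great_circle q e s = cos s *\<^sub>R q + sin s *\<^sub>R e"

text \<open>At a point \<open>x\<close> of a Riemannian manifold, the Laplace-Beltrami operator is the sum, over an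
  orthonormal frame, of the second derivatives at \<open>0\<close> along the geodesics from \<open>x\<close> in the frame
  directions. Its lift replaces these geodesics by their horizontal lifts. For
  \<open>\<S>\<^sup>4\<^sup>n\<^sup>+\<^sup>3 \<rightarrow> \<H>P\<^sup>n\<close> the lifts starting at \<open>q\<close> are the great circles with horizontal unit
  velocity, and for \<open>\<complex>P\<^sup>2\<^sup>n\<^sup>+\<^sup>1 \<rightarrow> \<H>P\<^sup>n\<close> they are the images under \<open>cproj\<close> of these great
  circles. On smooth functions the values depend neither on the frame nor on the representative.\<close>

definition sphere_subLaplacian :: "('n::finite hvec \<Rightarrow> real) \<Rightarrow> 'n hvec \<Rightarrow> real" where
  "sphere_subLaplacian f q =
     (\<Sum>e\<in>(SOME B. horizontal_frame q B). (deriv ^^ 2) (\<lambda>s. f (great_circle q e s)) 0)"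

definition CP_subLaplacian :: "('n::finite hvec set \<Rightarrow> real) \<Rightarrow> 'n hvec set \<Rightarrow> real" where
  "CP_subLaplacian f X =
     (\<Sum>e\<in>(SOME B. horizontal_frame (rep X) B).
        (deriv ^^ 2) (\<lambda>s. f (cproj (great_circle (rep X) e s))) 0)"


section \<open>Heat semigroups and heat kernels\<close>

text \<open>\<open>P\<close> is the semigroup \<open>e\<^sup>t\<^sup>A\<close> on the Banach space \<open>C\<close> of continuous functions on the compact
  space \<open>M\<close> (supremum norm): a strongly continuous semigroup of bounded linear operators whose
  infinitesimal generator agrees with \<open>A\<close> on the smooth functions \<open>D\<close>. For the two operators above,
  the closure of \<open>A\<close> on \<open>D\<close> is itself a generator, so that this determines \<open>P\<close>. Functions on \<open>M\<close>
  are represented by functions on the ambient type.\<close>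

definition heat_semigroup ::
  "'x set \<Rightarrow> ('x \<Rightarrow> real) set \<Rightarrow> ('x \<Rightarrow> real) set \<Rightarrow> (('x \<Rightarrow> real) \<Rightarrow> 'x \<Rightarrow> real)
    \<Rightarrow> (real \<Rightarrow> ('x \<Rightarrow> real) \<Rightarrow> 'x \<Rightarrow> real) \<Rightarrow> bool" where
  "heat_semigroup M C D A P \<longleftrightarrow>
     (\<forall>t\<ge>0. \<forall>f\<in>C. P t f \<in> C) \<and>
     (\<forall>t\<ge>0. \<forall>f\<in>C. \<forall>g\<in>C. \<forall>a b. \<forall>x\<in>M.
        P t (\<lambda>y. a * f y + b * g y) x = a * P t f x + b * P t g x) \<and>
     (\<forall>t\<ge>0. \<exists>K. \<forall>f\<in>C. \<forall>m. (\<forall>x\<in>M. \<bar>f x\<bar> \<le> m) \<longrightarrow> (\<forall>x\<in>M. \<bar>P t f x\<bar> \<le> K * m)) \<and>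
     (\<forall>f\<in>C. \<forall>x\<in>M. P 0 f x = f x) \<and>
     (\<forall>s\<ge>0. \<forall>t\<ge>0. \<forall>f\<in>C. \<forall>x\<in>M. P (s + t) f x = P s (P t f) x) \<and>
     (\<forall>f\<in>C. uniform_limit M (\<lambda>t. P t f) f (at_right 0)) \<and>
     (\<forall>f\<in>D. uniform_limit M (\<lambda>t x. (P t f x - f x) / t) (A f) (at_right 0))"

text \<open>The heat kernel from \<open>x\<^sub>0\<close> is the continuous density of \<open>f \<mapsto> e\<^sup>t\<^sup>A f (x\<^sub>0)\<close>; continuity singles
  out a representative with well-defined point values.\<close>

definition heat_kernel_from ::
  "'x measure \<Rightarrow> ('x \<Rightarrow> real) set \<Rightarrow> (real \<Rightarrow> ('x \<Rightarrow> real) \<Rightarrow> 'x \<Rightarrow> real) \<Rightarrow> 'x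
    \<Rightarrow> (real \<Rightarrow> 'x \<Rightarrow> real) \<Rightarrow> bool" where
  "heat_kernel_from \<mu> C P x\<^sub>0 k \<longleftrightarrow>
     (\<forall>t>0. k t \<in> C \<and> (\<forall>f\<in>C. P t f x\<^sub>0 = (\<integral>x. k t x * f x \<partial>\<mu>)))"


section \<open>Riemannian measures\<close>

text \<open>The Riemannian measure of the unit sphere gives a Borel set \<open>A\<close> the mass \<open>N \<lambda>(C\<^sub>A)\<close>, with
  \<open>\<lambda>\<close> Lebesgue measure, \<open>N\<close> the dimension of the ambient space and
  \<open>C\<^sub>A = {x. 0 < \<parallel>x\<parallel> \<le> 1, x / \<parallel>x\<parallel> \<in> A}\<close> the cone over \<open>A\<close>.\<close>

definition sphere_measure :: "'n::finite hvec measure" where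
  "sphere_measure =
     scale_measure (ennreal (real DIM('n hvec)))
       (distr (restrict_space lborel (cball 0 1 - {0})) (restrict_space borel hsphere) sgn)"

text \<open>\<open>CPspace\<close> carries the final sigma-algebra of \<open>cproj\<close>. Since \<open>cproj\<close> is a Riemannian submersion
  whose fibres are circles of length \<open>2 \<pi>\<close>, the Riemannian measure is \<open>1 / (2 \<pi>)\<close> times the image
  measure.\<close>

definition CP_sigma :: "'n::finite hvec set measure" where
  "CP_sigma = sigma CPspace
     {A. A \<subseteq> CPspace \<and> cproj -` A \<inter> hsphere \<in> sets (restrict_space borel hsphere)}"

definition CP_measure :: "'n::finite hvec set measure" where
  "CP_measure = scale_measure (ennreal (1 / (2 * pi))) (distr sphere_measure CP_sigma cproj)"


section \<open>Cylindrical coordinates\<close>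

text \<open>\<open>\<bar>q\<^sub>n\<^sub>+\<^sub>1\<bar> = cos r\<close> and \<open>Re q\<^sub>n\<^sub>+\<^sub>1 = cos r cos \<eta>\<close>; on the projective space
  \<open>q\<^sub>n\<^sub>+\<^sub>1 / \<bar>q\<^sub>n\<^sub>+\<^sub>1\<bar> = a + b J\<close> and \<open>\<bar>a\<bar> = cos \<phi>\<close>. The angles are meaningful only where
  \<open>q\<^sub>n\<^sub>+\<^sub>1 \<noteq> 0\<close>, that is \<open>r < \<pi> / 2\<close>.\<close>

definition coord_r :: "'n::finite hvec \<Rightarrow> real" where
  "coord_r q = arccos (norm (snd q))"

definition coord_eta :: "'n::finite hvec \<Rightarrow> real" where
  "coord_eta q = arccos (Re (fst (snd q)) / norm (snd q))"

definition coord_phi :: "'n::finite hvec \<Rightarrow> real" where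
  "coord_phi q = arccos (norm (fst (snd q)) / norm (snd q))"

text \<open>The multiple of the Riemannian measure of \<open>\<complex>P\<^sup>2\<^sup>n\<^sup>+\<^sup>1\<close> whose image under \<open>(r, \<phi>)\<close> is
  \<open>8 \<pi>\<^sup>2\<^sup>n\<^sup>+\<^sup>2 / \<Gamma>(2n) (sin r)\<^sup>4\<^sup>n\<^sup>-\<^sup>1 (cos r)\<^sup>3 sin 2\<phi> dr d\<phi>\<close> on \<open>[0, \<pi>/2] \<times> [0, \<pi>/2]\<close>.\<close>

definition CP_reference_measure :: "'n::finite hvec set measure \<Rightarrow> bool" where
  "CP_reference_measure \<nu> \<longleftrightarrow>
     (\<exists>c>0. \<nu> = scale_measure (ennreal c) CP_measure) \<and>
     distr \<nu> borel (\<lambda>X. (coord_r (rep X), coord_phi (rep X))) =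
       density lborel (\<lambda>(r, \<phi>).
         indicator ({0..pi/2} \<times> {0..pi/2}) (r, \<phi>) *
         ennreal (8 * pi ^ (2 * CARD('n) + 2) / Gamma (2 * real CARD('n)) *
           sin r ^ (4 * CARD('n) - 1) * cos r ^ 3 * sin (2 * \<phi>)))"


section \<open>Heat kernels in cylindrical coordinates\<close>

definition in_sphere_coords ::
  "(real \<Rightarrow> 'n::finite hvec \<Rightarrow> real) \<Rightarrow> (real \<Rightarrow> real \<Rightarrow> real \<Rightarrow> real) \<Rightarrow> bool" where
  "in_sphere_coords K p \<longleftrightarrow>
     (\<forall>t>0. \<forall>q\<in>hsphere. snd q \<noteq> 0 \<longrightarrow> K t q = p t (coord_r q) (coord_eta q))"

definition in_CP_coords ::
  "(real \<Rightarrow> 'n::finite hvec set \<Rightarrow> real) \<Rightarrow> (real \<Rightarrow> real \<Rightarrow> real \<Rightarrow> real) \<Rightarrow> bool" where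
  "in_CP_coords H h \<longleftrightarrow>
     (\<forall>t>0. \<forall>q\<in>hsphere. snd q \<noteq> 0 \<longrightarrow> H t (cproj q) = h t (coord_r q) (coord_phi q))"

end

theory Submission
  imports Defs
begin

text \<open>The semigroups are compared on polynomials. For a polynomial \<open>f\<close> of degree \<open>k\<close> on the sphere, the
  iterates \<open>L\<^sup>j f\<close> of the sub-Laplacian are polynomials of degree \<open>k\<close> of size at most \<open>c N\<^sup>j\<close>, so that any
  semigroup whose generator extends \<open>L\<close> is on \<open>f\<close> the exponential series \<open>\<Sum> t\<^sup>j L\<^sup>j f / j!\<close>. The same
  holds on the projective space for polynomials invariant under the circle, whose pullbacks to the sphere
  intertwine the two operators. Averaging over the circle preserves polynomials, hence the invariant ones
  are dense in the continuous invariant functions, and \<open>e\<^sup>t\<^sup>\<L> f (\<pi> q) = e\<^sup>t\<^sup>L (f \<circ> \<pi>) (q)\<close>. For the kernels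
  this says that \<open>h\<^sub>t \<circ> \<pi>\<close> is a multiple of the average of \<open>p\<^sub>t\<close> over the circle, and comparing the total
  masses of the two measures gives the factor \<open>1 / 2\<close>.\<close>

section \<open>Strongly continuous semigroups of bounded functions\<close>

text \<open>\<open>heat_semigroup\<close> describes a semigroup only through its generator on smooth
  functions, and its operator bounds may vary with the time in an uncontrolled way. An orbit can be
  differentiated at positive times only once these bounds are uniform on compact time intervals, so
  a uniform boundedness argument has to precede any uniqueness statement.

  The sub-Laplacian preserves the degree for a simple reason: projecting to the horizontal
  directions brings in coefficients quadratic in \<open>q\<close>, and two derivatives take the
  degree down by two again. For a fixed degree it is therefore a bounded operator in the coefficient
  norm, and its exponential series converges.

  The prescribed measure on the quotient has twice the mass of the sphere, although the fibres have
  length \<open>2 * pi\<close>. Hence \<open>2 * h\<close> is the normalised mean of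
  \<open>p\<close> over a circle, and folding the circle onto \<open>{0..pi}\<close> by the symmetry
  of the cosine leaves the factor \<open>1 / (2 * pi)\<close>.\<close>

locale heat_semigroup_on =
  fixes M :: "'x set" and C D :: "('x \<Rightarrow> real) set"
    and A :: "('x \<Rightarrow> real) \<Rightarrow> 'x \<Rightarrow> real" and P :: "real \<Rightarrow> ('x \<Rightarrow> real) \<Rightarrow> 'x \<Rightarrow> real"
  assumes sg: "heat_semigroup M C D A P"
    and C_lin: "\<And>f g a b. f \<in> C \<Longrightarrow> g \<in> C \<Longrightarrow> (\<lambda>y. a * f y + b * g y) \<in> C"
    and C_zero: "(\<lambda>_. 0) \<in> C"
    and C_bounded: "\<And>f. f \<in> C \<Longrightarrow> \<exists>m. \<forall>x\<in>M. \<bar>f x\<bar> \<le> m"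
    and C_closed: "\<And>u f. (\<And>n. u n \<in> C) \<Longrightarrow> uniform_limit M u f sequentially \<Longrightarrow> f \<in> C"
begin

lemma P_in_C: "t \<ge> 0 \<Longrightarrow> f \<in> C \<Longrightarrow> P t f \<in> C"
  and P_lin: "t \<ge> 0 \<Longrightarrow> f \<in> C \<Longrightarrow> g \<in> C \<Longrightarrow> x \<in> M \<Longrightarrow>
    P t (\<lambda>y. a * f y + b * g y) x = a * P t f x + b * P t g x"
  and P_0: "f \<in> C \<Longrightarrow> x \<in> M \<Longrightarrow> P 0 f x = f x"
  and P_add: "s \<ge> 0 \<Longrightarrow> t \<ge> 0 \<Longrightarrow> f \<in> C \<Longrightarrow> x \<in> M \<Longrightarrow> P (s + t) f x = P s (P t f) x"
  and P_cont_0: "f \<in> C \<Longrightarrow> uniform_limit M (\<lambda>t. P t f) f (at_right 0)"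
  and P_gen: "f \<in> D \<Longrightarrow> uniform_limit M (\<lambda>t x. (P t f x - f x) / t) (A f) (at_right 0)"
  using sg by (auto simp: heat_semigroup_def)

lemma P_bounded:
  assumes "t \<ge> 0"
  obtains K where "\<And>f m x. f \<in> C \<Longrightarrow> (\<forall>x\<in>M. \<bar>f x\<bar> \<le> m) \<Longrightarrow> x \<in> M \<Longrightarrow> \<bar>P t f x\<bar> \<le> K * m"
  using sg assms unfolding heat_semigroup_def by meson

lemma C_diff: "f \<in> C \<Longrightarrow> g \<in> C \<Longrightarrow> (\<lambda>y. f y - g y) \<in> C"
  and C_cmult: "f \<in> C \<Longrightarrow> (\<lambda>y. a * f y) \<in> C"
  and C_add_cmult: "f \<in> C \<Longrightarrow> g \<in> C \<Longrightarrow> (\<lambda>y. f y + a * g y) \<in> C"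
  using C_lin[of f g 1 "-1"] C_lin[of f f a 0] C_lin[of f g 1 a] by simp_all

lemma P_diff: "t \<ge> 0 \<Longrightarrow> f \<in> C \<Longrightarrow> g \<in> C \<Longrightarrow> x \<in> M \<Longrightarrow> P t (\<lambda>y. f y - g y) x = P t f x - P t g x"
  and P_cmult: "t \<ge> 0 \<Longrightarrow> f \<in> C \<Longrightarrow> x \<in> M \<Longrightarrow> P t (\<lambda>y. a * f y) x = a * P t f x"
  and P_add_cmult: "t \<ge> 0 \<Longrightarrow> f \<in> C \<Longrightarrow> g \<in> C \<Longrightarrow> x \<in> M \<Longrightarrow>
    P t (\<lambda>y. f y + a * g y) x = P t f x + a * P t g x"
  using P_lin[of t f g x 1 "-1"] P_lin[of t f f x a 0] P_lin[of t f g x 1 a] by simp_all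

text \<open>Functions live on the whole ambient type, but only their values on \<open>M\<close>
  count. The operator bound, applied to a difference with \<open>m = 0\<close>, shows that
  \<open>P t\<close> respects this.\<close>

lemma P_cong:
  assumes "t \<ge> 0" "f \<in> C" "g \<in> C" "\<And>x. x \<in> M \<Longrightarrow> f x = g x" "x \<in> M"
  shows "P t f x = P t g x"
proof -
  obtain K where "\<And>f m x. f \<in> C \<Longrightarrow> (\<forall>x\<in>M. \<bar>f x\<bar> \<le> m) \<Longrightarrow> x \<in> M \<Longrightarrow> \<bar>P t f x\<bar> \<le> K * m"
    using P_bounded[OF assms(1)] by metis
  from this[of "\<lambda>y. f y - g y" 0 x] have "\<bar>P t (\<lambda>y. f y - g y) x\<bar> \<le> 0"
    using assms by (auto intro: C_diff)
  then show ?thesis using P_diff assms by simp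
qed

section \<open>Operator norms and their boundedness near time zero\<close>

definition opnorm :: "real \<Rightarrow> real" where
  "opnorm t = Sup {\<bar>P t f x\<bar> | f x. f \<in> C \<and> (\<forall>y\<in>M. \<bar>f y\<bar> \<le> 1) \<and> x \<in> M}"

lemma opnorm_bdd_above:
  assumes "t \<ge> 0"
  shows "bdd_above {\<bar>P t f x\<bar> | f x. f \<in> C \<and> (\<forall>y\<in>M. \<bar>f y\<bar> \<le> 1) \<and> x \<in> M}"
proof -
  obtain K where "\<And>f m x. f \<in> C \<Longrightarrow> (\<forall>x\<in>M. \<bar>f x\<bar> \<le> m) \<Longrightarrow> x \<in> M \<Longrightarrow> \<bar>P t f x\<bar> \<le> K * m"
    using P_bounded[OF assms] by metis
  then show ?thesis
    by (intro bdd_aboveI[of _ "K * 1"]) blast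
qed

lemma opnorm_upper:
  assumes "t \<ge> 0" "f \<in> C" "\<And>y. y \<in> M \<Longrightarrow> \<bar>f y\<bar> \<le> m" "x \<in> M"
  shows "\<bar>P t f x\<bar> \<le> opnorm t * m"
proof (cases "m > 0")
  case True
  have *: "\<bar>(1/m) * f y\<bar> \<le> 1" if "y \<in> M" for y
    using assms(3)[OF that] True by (simp add: abs_mult field_simps)
  have "\<bar>P t (\<lambda>y. (1/m) * f y) x\<bar> \<le> opnorm t"
    unfolding opnorm_def
    by (rule cSup_upper[OF _ opnorm_bdd_above[OF assms(1)]])
       (use assms * C_cmult[of f "1/m"] in blast)
  moreover have "P t (\<lambda>y. (1/m) * f y) x = (1/m) * P t f x"
    by (rule P_cmult) (use assms in auto)
  ultimately have "\<bar>(1/m) * P t f x\<bar> \<le> opnorm t" by metis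
  then show ?thesis using True by (simp add: abs_mult field_simps)
next
  case False
  with assms(3)[OF assms(4)] have "m = 0" by linarith
  with assms(3) have "f y = 0" if "y \<in> M" for y using that by fastforce
  then have "P t f x = P t (\<lambda>y. 0 * f y) x"
    by (intro P_cong) (use assms C_cmult[of f 0] in auto)
  also have "\<dots> = 0" using P_cmult[OF assms(1,2,4), of 0] by simp
  finally show ?thesis using \<open>m = 0\<close> by simp
qed

text \<open>Any fraction strictly between 1/2 and 1 would serve: in the gliding-hump argument the
  tail of the series takes away one half.\<close>

lemma opnorm_near:
  assumes "t \<ge> 0" "opnorm t > 0" "M \<noteq> {}"
  obtains f x where "f \<in> C" "\<And>y. y \<in> M \<Longrightarrow> \<bar>f y\<bar> \<le> 1" "x \<in> M" "\<bar>P t f x\<bar> > 2 / 3 * opnorm t"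
proof -
  have "\<exists>z\<in>{\<bar>P t f x\<bar> | f x. f \<in> C \<and> (\<forall>y\<in>M. \<bar>f y\<bar> \<le> 1) \<and> x \<in> M}. z > 2 / 3 * opnorm t"
  proof (rule less_cSupD)
    show "{\<bar>P t f x\<bar> | f x. f \<in> C \<and> (\<forall>y\<in>M. \<bar>f y\<bar> \<le> 1) \<and> x \<in> M} \<noteq> {}"
      using C_zero assms(3) by fastforce
    show "2 / 3 * opnorm t < Sup {\<bar>P t f x\<bar> | f x. f \<in> C \<and> (\<forall>y\<in>M. \<bar>f y\<bar> \<le> 1) \<and> x \<in> M}"
      using assms(2) unfolding opnorm_def[symmetric] by simp
  qed
  then show ?thesis using that by blast
qed

text \<open>Sokal's gliding-hump proof of the uniform boundedness principle: if \<open>opnorm (t n) \<ge> 6 * 4^n\<close>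
  along \<open>t n \<longrightarrow> 0\<close>, then \<open>\<Sum> \<plusminus> 3^-n h n\<close>, with \<open>h n\<close> nearly extremal for \<open>P (t n)\<close> and suitable
  signs, has an unbounded orbit near \<open>0\<close>.\<close>

lemma opnorm_bounded_near_0:
  "\<exists>\<delta>>0. \<exists>K\<ge>1. \<forall>t. 0 \<le> t \<longrightarrow> t \<le> \<delta> \<longrightarrow> opnorm t \<le> K"
proof (cases "M = {}")
  case True
  \<comment> \<open>With \<open>M\<close> empty, \<open>opnorm t\<close> is the supremum of the
    empty set, one and the same number for all \<open>t\<close>.\<close>
  have "opnorm t \<le> max 1 (opnorm 0)" for t unfolding opnorm_def using True by auto
  then show ?thesis by (meson max.cobounded1 zero_less_one)
next
  case False
  show ?thesis
  proof (rule ccontr)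
    assume "\<not> ?thesis"
    then have neg: "\<exists>t. 0 \<le> t \<and> t \<le> \<delta> \<and> opnorm t > K" if "\<delta> > 0" "K \<ge> 1" for \<delta> K
      using that by (meson not_le)
    have "1 \<le> 6 * (4::real) ^ n" for n
      by (rule order_trans[OF one_le_power[of "4::real" n]]) simp_all
    then have "\<exists>t. 0 \<le> t \<and> t \<le> 1 / real (Suc n) \<and> opnorm t > 6 * 4 ^ n" for n
      by (intro neg) auto
    then obtain t where t: "\<And>n. 0 \<le> t n" "\<And>n. t n \<le> 1 / real (Suc n)" "\<And>n. opnorm (t n) > 6 * 4 ^ n"
      by metis
    have op_pos: "opnorm (t n) > 0" for n
      using t(3)[of n] by (smt (verit) zero_le_power)
    have "\<exists>f x. f \<in> C \<and> (\<forall>y\<in>M. \<bar>f y\<bar> \<le> 1) \<and> x \<in> M \<and> \<bar>P (t n) f x\<bar> > 2 / 3 * opnorm (t n)" for n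
      using opnorm_near[OF t(1) op_pos False, of n] by metis
    then obtain h x where h: "\<And>n. h n \<in> C" "\<And>n y. y \<in> M \<Longrightarrow> \<bar>h n y\<bar> \<le> 1" "\<And>n. x n \<in> M"
      "\<And>n. \<bar>P (t n) (h n) (x n)\<bar> > 2 / 3 * opnorm (t n)"
      by metis
    \<comment> \<open>For reals \<open>u\<close> and \<open>v\<close>, one of
      \<open>\<bar>u + v\<bar>\<close> and \<open>\<bar>u - v\<bar>\<close> is at least
      \<open>\<bar>v\<bar>\<close>. So some sign keeps the new hump visible, whatever the earlier
      ones contribute at \<open>x n\<close>.\<close>
    define sgn_at where "sgn_at n f = (if \<bar>P (t n) (\<lambda>y. f y + (1/3)^n * h n y) (x n)\<bar>
      \<ge> (1/3)^n * (2 / 3 * opnorm (t n)) then (1::real) else -1)" for n f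
    define F where "F = rec_nat (\<lambda>_. 0) (\<lambda>n f y. f y + sgn_at n f * (1/3)^n * h n y)"
    define s where "s n = sgn_at n (F n)" for n
    have F_0: "F 0 = (\<lambda>_. 0)" and F_Suc: "F (Suc n) = (\<lambda>y. F n y + (s n * (1/3)^n) * h n y)" for n
      by (simp_all add: F_def s_def)
    have s_abs: "\<bar>s n\<bar> = 1" for n by (simp add: s_def sgn_at_def)
    have F_C: "F n \<in> C" for n
      by (induction n) (simp_all only: F_0 F_Suc C_zero C_add_cmult h)
    have F_sum: "F n y = (\<Sum>i<n. s i * (1/3)^i * h i y)" for n y
      by (induction n) (simp_all add: F_0 F_Suc)
    have big: "\<bar>P (t n) (F (Suc n)) (x n)\<bar> \<ge> (1/3)^n * (2 / 3 * opnorm (t n))" for n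
    proof -
      let ?L = "(1/3)^n * (2 / 3 * opnorm (t n))"
      have lin: "P (t n) (\<lambda>y. F n y + a * h n y) (x n)
          = P (t n) (F n) (x n) + a * P (t n) (h n) (x n)" for a
        by (rule P_add_cmult) (use t h F_C in auto)
      have "\<bar>(1/3)^n * P (t n) (h n) (x n)\<bar> \<ge> ?L"
        using h(4)[of n] by (simp add: abs_mult)
      then have "\<bar>P (t n) (\<lambda>y. F n y + (1/3)^n * h n y) (x n)\<bar> \<ge> ?L \<or>
            \<bar>P (t n) (\<lambda>y. F n y + (-1 * (1/3)^n) * h n y) (x n)\<bar> \<ge> ?L"
        unfolding lin by (smt (verit) mult_minus_left mult_1)
      then show ?thesis
        unfolding F_Suc s_def by (auto simp: sgn_at_def)
    qed
    define f where "f y = (\<Sum>i. s i * (1/3)^i * h i y)" for y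
    have term_le: "\<bar>s i * (1/3)^i * h i y\<bar> \<le> (1/3)^i" if "y \<in> M" for i y
      using h(2)[OF that, of i] s_abs[of i] by (simp add: abs_mult mult_left_le)
    have "uniform_limit M (\<lambda>n y. \<Sum>i<n. s i * (1/3)^i * h i y) (\<lambda>y. \<Sum>i. s i * (1/3)^i * h i y) sequentially"
      by (rule Weierstrass_m_test[where M = "\<lambda>i. (1/3)^i"]) (use term_le in \<open>auto intro: summable_geometric\<close>)
    then have "uniform_limit M F f sequentially"
      by (simp add: f_def[abs_def] F_sum[abs_def])
    then have f_C: "f \<in> C" using C_closed F_C by blast
    have tail: "\<bar>f y - F (Suc n) y\<bar> \<le> (1/3)^n / 2" if "y \<in> M" for n y
    proof -
      have sm: "summable (\<lambda>i. s i * (1/3)^i * h i y)"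
        by (rule summable_comparison_test'[of "\<lambda>i. (1/3)^i" 0]) (use term_le that in \<open>auto intro: summable_geometric\<close>)
      have sg3: "summable (\<lambda>i. (1/3::real)^(i + Suc n))"
        by (intro summable_ignore_initial_segment summable_geometric) auto
      have "f y - F (Suc n) y = (\<Sum>i. s (i + Suc n) * (1/3)^(i + Suc n) * h (i + Suc n) y)"
        unfolding f_def F_sum using suminf_minus_initial_segment[OF sm, of "Suc n"] by simp
      moreover have "\<bar>\<dots>\<bar> \<le> (\<Sum>i. (1/3)^(i + Suc n))"
        unfolding real_norm_def[symmetric]
        by (rule norm_suminf_le) (use term_le[OF that] sg3 in \<open>simp_all only: real_norm_def\<close>)
      moreover have "(\<Sum>i. (1/3::real)^(i + Suc n)) = (1/3)^n / 2"
        using suminf_mult2[OF summable_geometric[of "1/3::real"], of "(1/3)^Suc n"]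
        by (simp add: power_add suminf_geometric)
      ultimately show ?thesis by simp
    qed
    obtain m where m: "\<And>y. y \<in> M \<Longrightarrow> \<bar>f y\<bar> \<le> m" using C_bounded[OF f_C] by blast
    have "\<forall>\<^sub>F t in at_right 0. \<forall>y\<in>M. dist (P t f y) (f y) < 1"
      using P_cont_0[OF f_C] by (rule uniform_limitD) simp
    then obtain b where b: "b > 0" "\<And>t y. 0 < t \<Longrightarrow> t < b \<Longrightarrow> y \<in> M \<Longrightarrow> dist (P t f y) (f y) < 1"
      unfolding eventually_at_right_field by blast
    have orbit: "\<bar>P t f y\<bar> < m + 1" if "0 \<le> t" "t < b" "y \<in> M" for t y
    proof (cases "t = 0")
      case True
      with that show ?thesis using P_0[OF f_C that(3)] m[OF that(3)] by simp
    next
      case False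
      with that show ?thesis using b(2)[of t y] m[OF that(3)] by (simp add: dist_real_def)
    qed
    obtain n1 where n1: "1 / b < real n1" using reals_Archimedean2 by blast
    obtain n2 where n2: "m + 1 < (4/3::real)^n2" using real_arch_pow[of "4/3" "m+1"] by auto
    define n where "n = max n1 n2"
    have "1 / real (Suc n) < b"
      using n1 b(1) unfolding n_def by (simp add: field_simps) (smt (verit) max.cobounded1 mult_left_mono of_nat_mono)
    then have tb: "t n < b" using t(2)[of n] by linarith
    \<comment> \<open>Here \<open>w\<close> is \<open>(1/3)^n * opnorm (t n)\<close>. The hump is at
      least two thirds of \<open>w\<close>, the tail at most half of it, so a sixth survives; since
      \<open>opnorm (t n) > 6 * 4 ^ n\<close>, this is at least \<open>(4/3) ^ n\<close>.\<close>
    have triangle: "\<bar>a - b\<bar> \<le> w / 2 \<Longrightarrow> \<bar>b\<bar> \<ge> 2 / 3 * w \<Longrightarrow> \<bar>a\<bar> \<ge> w / 6" for a b w :: real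
      by arith
    have "\<bar>P (t n) (\<lambda>y. f y - F (Suc n) y) (x n)\<bar> \<le> opnorm (t n) * ((1/3)^n / 2)"
      by (rule opnorm_upper) (use tail t h f_C F_C in \<open>auto intro: C_diff\<close>)
    then have "\<bar>P (t n) f (x n) - P (t n) (F (Suc n)) (x n)\<bar> \<le> opnorm (t n) * ((1/3)^n / 2)"
      by (subst (asm) P_diff) (use t h f_C F_C in auto)
    then have "\<bar>P (t n) f (x n)\<bar> \<ge> (1/3)^n * opnorm (t n) / 6"
      using big[of n] triangle[of "P (t n) f (x n)" "P (t n) (F (Suc n)) (x n)" "(1/3)^n * opnorm (t n)"]
      by (simp add: mult_ac)
    moreover have "(1/3)^n * opnorm (t n) / 6 \<ge> (1/3)^n * (6 * 4^n) / (6::real)"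
      by (intro divide_right_mono mult_left_mono) (use t(3)[of n] in auto)
    moreover have "(1/3)^n * (6 * 4^n) / (6::real) = (4/3)^n"
      by (simp add: power_divide)
    moreover have "(4/3::real)^n \<ge> (4/3)^n2"
      by (rule power_increasing) (auto simp: n_def)
    ultimately show False using orbit[OF t(1) tb h(3), of n] n2 by linarith
  qed
qed

text \<open>The semigroup law spreads the bound near zero: a time up to \<open>n * \<delta>\<close>
  splits into \<open>n\<close> steps of length at most \<open>\<delta>\<close>, each costing a
  factor \<open>K\<close>.\<close>

lemma P_uniformly_bounded:
  obtains K where "K \<ge> 1" "\<And>t f m x. 0 \<le> t \<Longrightarrow> t \<le> T \<Longrightarrow> f \<in> C \<Longrightarrow> (\<And>y. y \<in> M \<Longrightarrow> \<bar>f y\<bar> \<le> m)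
    \<Longrightarrow> x \<in> M \<Longrightarrow> \<bar>P t f x\<bar> \<le> K * m"
proof -
  obtain \<delta> K where \<delta>: "\<delta> > 0" and K: "K \<ge> 1" and op: "\<And>t. 0 \<le> t \<Longrightarrow> t \<le> \<delta> \<Longrightarrow> opnorm t \<le> K"
    using opnorm_bounded_near_0 by metis
  have step: "\<bar>P t f x\<bar> \<le> K * m" if "0 \<le> t" "t \<le> \<delta>" "f \<in> C" "\<And>y. y \<in> M \<Longrightarrow> \<bar>f y\<bar> \<le> m" "x \<in> M" for t f m x
  proof -
    have "m \<ge> 0" using that(4)[OF that(5)] by linarith
    then have "opnorm t * m \<le> K * m" using op[OF that(1,2)] by (rule mult_right_mono[rotated])
    then show ?thesis using opnorm_upper[OF that(1,3) that(4) that(5)] by fastforce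
  qed
  have iter: "\<bar>P t f x\<bar> \<le> K ^ n * m"
    if "0 \<le> t" "t \<le> real n * \<delta>" "f \<in> C" "\<And>y. y \<in> M \<Longrightarrow> \<bar>f y\<bar> \<le> m" "x \<in> M" for n t f m x
    using that
  proof (induction n arbitrary: t x)
    case 0
    then have "t = 0" by simp
    with 0 show ?case by (simp add: P_0)
  next
    case (Suc n)
    define u where "u = min t (real n * \<delta>)"
    have u: "0 \<le> u" "u \<le> real n * \<delta>" "0 \<le> t - u" "t - u \<le> \<delta>"
      using Suc.prems \<delta> by (auto simp: u_def min_def algebra_simps)
    have "P t f x = P (t - u) (P u f) x"
      using P_add[OF u(3,1) Suc.prems(3,5)] by simp
    also have "\<bar>\<dots>\<bar> \<le> K * (K ^ n * m)"
      using Suc.IH[OF u(1,2) Suc.prems(3,4)] Suc.prems u by (intro step P_in_C) auto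
    finally show ?case by (simp add: mult_ac)
  qed
  obtain n where n: "T / \<delta> < real n" using reals_Archimedean2 by blast
  then have T: "T \<le> real n * \<delta>" using \<delta> by (simp add: field_simps)
  show ?thesis
    by (rule that[of "K ^ n"]) (use K iter[of _ n] T in \<open>auto intro: one_le_power\<close>)
qed

text \<open>The generator provides only a right derivative at time zero. The semigroup law and the
  uniform bound transport it to a right derivative at \<open>s\<close>, with an error uniform in
  \<open>s\<close>. To the left of \<open>t\<close> the increment is a forward step from the earlier
  time \<open>y\<close>, and strong continuity controls the change from \<open>P y g\<close> to
  \<open>P t g\<close>. The function \<open>g\<close> represents \<open>A f\<close>, which matters
  only on \<open>M\<close>.\<close>

lemma P_orbit_derivative:
  assumes f: "f \<in> C" "f \<in> D" and g: "g \<in> C" "\<And>x. x \<in> M \<Longrightarrow> A f x = g x" and x: "x \<in> M"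
    and t: "0 \<le> t" "t \<le> T"
  shows "((\<lambda>t. P t f x) has_field_derivative P t g x) (at t within {0..T})"
proof -
  obtain K where K: "K \<ge> 1" and bd: "\<And>t f m x. 0 \<le> t \<Longrightarrow> t \<le> T \<Longrightarrow> f \<in> C \<Longrightarrow>
      (\<And>y. y \<in> M \<Longrightarrow> \<bar>f y\<bar> \<le> m) \<Longrightarrow> x \<in> M \<Longrightarrow> \<bar>P t f x\<bar> \<le> K * m"
    using P_uniformly_bounded[of T] by metis
  have "\<exists>d>0. \<forall>y\<in>{0..T}. norm (y - t) < d \<longrightarrow>
      norm (P y f x - P t f x - P t g x * (y - t)) \<le> e * norm (y - t)" if e: "e > 0" for e
  proof -
    \<comment> \<open>Transport by \<open>P s\<close> costs a factor \<open>K\<close>, and the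
      backward increment adds two such errors; each may use half of \<open>e\<close>.\<close>
    define e' where "e' = e / (2 * K)"
    have e': "e' > 0" "K * e' = e / 2" using e K by (auto simp: e'_def field_simps)
    have "\<forall>\<^sub>F h in at_right 0. \<forall>y\<in>M. dist ((P h f y - f y) / h) (A f y) < e'"
      using P_gen[OF f(2)] e' by (intro uniform_limitD)
    moreover have "\<forall>\<^sub>F h in at_right 0. \<forall>y\<in>M. dist (P h g y) (g y) < e'"
      using P_cont_0[OF g(1)] e' by (intro uniform_limitD)
    ultimately have "\<forall>\<^sub>F h in at_right 0. \<forall>y\<in>M. dist ((P h f y - f y) / h) (A f y) < e' \<and> dist (P h g y) (g y) < e'"
      by eventually_elim blast
    then obtain d where d: "d > 0" "\<And>h y. 0 < h \<Longrightarrow> h < d \<Longrightarrow> y \<in> M \<Longrightarrow>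
        dist ((P h f y - f y) / h) (A f y) < e' \<and> dist (P h g y) (g y) < e'"
      unfolding eventually_at_right_field by blast
    have fwd: "\<bar>P (s + h) f x - P s f x - h * P s g x\<bar> \<le> e / 2 * h"
      if s: "0 \<le> s" "s \<le> T" and h: "0 < h" "h < d" for s h
    proof -
      define w where "w = (\<lambda>y. (P h f y - f y) - h * g y)"
      have wC: "w \<in> C" unfolding w_def
        using f g h by (intro C_diff C_cmult P_in_C) auto
      have "\<bar>w y\<bar> \<le> h * e'" if "y \<in> M" for y
      proof -
        have "w y = h * ((P h f y - f y) / h - A f y)"
          using h g(2)[OF that] by (simp add: w_def field_simps)
        then show ?thesis
          using d(2)[OF h that] h by (simp add: abs_mult dist_real_def mult_left_mono)
      qed
      from bd[OF s wC this x] have "\<bar>P s w x\<bar> \<le> K * (h * e')" by simp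
      also have "\<dots> = e / 2 * h" using e'(2) by (metis mult.assoc mult.commute)
      also have "P s w x = P s (P h f) x - P s f x - h * P s g x"
        unfolding w_def using f g h s x by (simp add: P_diff P_cmult C_diff C_cmult P_in_C)
      finally show ?thesis using P_add[of s h f x] s h f x by simp
    qed
    have cont: "\<bar>P (s + h) g x - P s g x\<bar> \<le> e / 2" if s: "0 \<le> s" "s \<le> T" and h: "0 < h" "h < d" for s h
    proof -
      have "\<bar>P s (\<lambda>y. P h g y - g y) x\<bar> \<le> K * e'"
        using d(2)[OF h] g h x by (intro bd s C_diff P_in_C) (auto simp: dist_real_def less_imp_le)
      then show ?thesis using P_add[of s h g x] e'(2) s h g x by (simp add: P_diff P_in_C)
    qed
    have "\<bar>P y f x - P t f x - P t g x * (y - t)\<bar> \<le> e * \<bar>y - t\<bar>" if y: "0 \<le> y" "y \<le> T" "\<bar>y - t\<bar> < d" for y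
    proof -
      consider "y = t" | "y > t" | "y < t" by linarith
      then show ?thesis
      proof cases
        case 2
        then have "\<bar>P y f x - P t f x - P t g x * (y - t)\<bar> \<le> e / 2 * (y - t)"
          using fwd[of t "y - t"] t y by (simp add: mult.commute)
        also have "\<dots> \<le> e * \<bar>y - t\<bar>" using 2 e by simp
        finally show ?thesis .
      next
        case 3
        have 1: "\<bar>P t f x - P y f x - (t - y) * P y g x\<bar> \<le> e / 2 * (t - y)"
          using fwd[of y "t - y"] 3 y by simp
        have "\<bar>P t g x - P y g x\<bar> \<le> e / 2" using cont[of y "t - y"] 3 y by simp
        then have 2: "\<bar>(t - y) * (P t g x - P y g x)\<bar> \<le> (t - y) * (e / 2)"
          unfolding abs_mult using 3 by (intro mult_mono) auto
        have "P y f x - P t f x - P t g x * (y - t)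
            = (t - y) * (P t g x - P y g x) - (P t f x - P y f x - (t - y) * P y g x)"
          by (simp add: algebra_simps)
        then have "\<bar>P y f x - P t f x - P t g x * (y - t)\<bar> \<le> (t - y) * (e / 2) + e / 2 * (t - y)"
          using 1 2 by linarith
        also have "\<dots> = e * \<bar>y - t\<bar>" using 3 by simp
        finally show ?thesis .
      qed simp
    qed
    with d(1) show ?thesis by (auto simp del: abs_le_iff)
  qed
  then show ?thesis
    unfolding has_field_derivative_def has_derivative_within_alt
    by (auto intro: bounded_linear_mult_right)
qed

text \<open>On a sequence \<open>A (f j) = f (j + 1)\<close> of geometric growth the semigroup is the exponential series,
  whatever \<open>P\<close> is. This replaces the uniqueness of the semigroup generated by the closure of \<open>A\<close>.\<close>

lemma P_exp_series:
  assumes f: "\<And>j. f j \<in> C" "\<And>j. f j \<in> D" and A: "\<And>j x. x \<in> M \<Longrightarrow> A (f j) x = f (Suc j) x"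
    and N: "\<And>j x. x \<in> M \<Longrightarrow> \<bar>f j x\<bar> \<le> c * N ^ j" and x: "x \<in> M" and t: "t \<ge> 0"
  shows "(\<lambda>j. f j x * t ^ j / fact j) sums P t (f 0) x"
proof -
  obtain K where K: "K \<ge> 1" and bd: "\<And>s f m x. 0 \<le> s \<Longrightarrow> s \<le> t \<Longrightarrow> f \<in> C \<Longrightarrow>
      (\<And>y. y \<in> M \<Longrightarrow> \<bar>f y\<bar> \<le> m) \<Longrightarrow> x \<in> M \<Longrightarrow> \<bar>P s f x\<bar> \<le> K * m"
    using P_uniformly_bounded[of t] by metis
  let ?r = "\<lambda>n. K * c * N * t * ((N * t) ^ n / fact n)"
  \<comment> \<open>Successive derivatives of the orbit of \<open>f 0\<close> are the orbits of the
    \<open>f i\<close>, so Taylor's formula applies. Its remainder has the exponent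
    \<open>Suc n\<close> over \<open>fact n\<close>, which is why a factor \<open>N * t\<close>
    stays outside in \<open>?r\<close>.\<close>
  have est: "\<bar>P t (f 0) x - (\<Sum>j<Suc n. f j x * t ^ j / fact j)\<bar> \<le> ?r n" for n
  proof -
    have "norm (P t (f 0) x - (\<Sum>i\<le>n. P 0 (f i) x * (t - 0) ^ i / fact i))
        \<le> K * (c * N ^ Suc n) * norm (t - 0) ^ Suc n / fact n"
      by (rule field_Taylor[of "{0..t}"])
         (use f A x t bd N in \<open>auto intro!: P_orbit_derivative bd simp del: power_Suc\<close>)
    moreover have "K * (c * N ^ Suc n) * t ^ Suc n / fact n = ?r n"
      by (simp add: power_mult_distrib)
    ultimately show ?thesis using t
      by (simp only: P_0[OF f(1) x] lessThan_Suc_atMost real_norm_def diff_0_right abs_of_nonneg)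
  qed
  have "(\<lambda>n. (N * t) ^ n / fact n) \<longlonglongrightarrow> 0"
    using summable_LIMSEQ_zero[OF summable_exp[of "N * t"]] by (simp add: field_simps)
  then have "?r \<longlonglongrightarrow> 0" using tendsto_mult_right_zero by blast
  then have "(\<lambda>n. P t (f 0) x - (\<Sum>j<Suc n. f j x * t ^ j / fact j)) \<longlonglongrightarrow> 0"
    by (rule Lim_null_comparison[rotated]) (use est in \<open>auto simp del: sum.lessThan_Suc\<close>)
  then have "(\<lambda>n. \<Sum>j<Suc n. f j x * t ^ j / fact j) \<longlonglongrightarrow> P t (f 0) x"
    using tendsto_diff[OF tendsto_const[of "P t (f 0) x"]] by fastforce
  then show ?thesis
    unfolding sums_def by (rule LIMSEQ_imp_Suc)
qed

end


section \<open>Quaternions and horizontal frames\<close>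

definition hI :: quat where "hI = (\<i>, 0)"
definition hJ :: quat where "hJ = (0, 1)"
definition hK :: quat where "hK = (0, \<i>)"

lemma qmult_add_left: "qmult (u + v) p = qmult u p + qmult v p"
  and qmult_scaleR_left: "qmult (c *\<^sub>R v) p = c *\<^sub>R qmult v p"
  and qmult_add_right: "qmult v (p + q) = qmult v p + qmult v q"
  and qmult_scaleR_right: "qmult v (c *\<^sub>R p) = c *\<^sub>R qmult v p"
  by (auto simp: qmult_def algebra_simps)

lemma qact_add_left: "qact (u + v) q = qact u q + qact v q"
  and qact_scaleR_left: "qact (c *\<^sub>R v) q = c *\<^sub>R qact v q"
  and qact_add_right: "qact v (p + q) = qact v p + qact v q"
  and qact_scaleR_right: "qact v (c *\<^sub>R q) = c *\<^sub>R qact v q"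
  by (simp_all add: qact_def vec_eq_iff prod_eq_iff qmult_add_left qmult_scaleR_left
      qmult_add_right qmult_scaleR_right)

lemma qact_one [simp]: "qact (1, 0) q = q"
  by (simp add: qact_def qmult_def prod_eq_iff vec_eq_iff)

lemma qact_qact: "qact u (qact v q) = qact (qmult u v) q"
  by (simp add: qact_def qmult_def prod_eq_iff vec_eq_iff algebra_simps)

lemma inner_hvec: "(x :: 'n::finite hvec) \<bullet> y = (\<Sum>i\<in>UNIV. fst x $ i \<bullet> fst y $ i) + snd x \<bullet> snd y"
  by (simp add: inner_prod_def inner_vec_def)

lemma qmult_skew: "Re (fst v) = 0 \<Longrightarrow> p \<bullet> qmult v q = - (qmult v p \<bullet> q)"
  by (simp add: qmult_def inner_prod_def inner_complex_def algebra_simps)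

lemma qact_skew: "Re (fst v) = 0 \<Longrightarrow> p \<bullet> qact v q = - (qact v p \<bullet> q)"
  by (simp add: inner_hvec qact_def qmult_skew sum_negf)

lemma qmult_inner: "qmult g p \<bullet> qmult g q = (norm g)\<^sup>2 * (p \<bullet> q)"
  by (simp add: power2_norm_eq_inner qmult_def inner_prod_def inner_complex_def algebra_simps)

lemma qact_inner: "qact g p \<bullet> qact g q = (norm g)\<^sup>2 * (p \<bullet> q)"
  by (simp add: inner_hvec qact_def qmult_inner sum_distrib_left algebra_simps)

lemma norm_qact: "norm (qact g q) = norm g * norm q"
  by (simp add: norm_eq_sqrt_inner[of "qact g q"] qact_inner real_sqrt_mult norm_eq_sqrt_inner[of q])

lemma inner_qact_self: "Re (fst v) = 0 \<Longrightarrow> q \<bullet> qact v q = 0"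
  using qact_skew[of v q q] by (simp add: inner_commute)

lemma norm_units: "norm hI = 1" "norm hJ = 1" "norm hK = 1"
  by (simp_all add: hI_def hJ_def hK_def norm_prod_def)

lemma units_imaginary: "Re (fst hI) = 0" "Re (fst hJ) = 0" "Re (fst hK) = 0"
  by (simp_all add: hI_def hJ_def hK_def)

lemma imaginary_expansion:
  "Re (fst v) = 0 \<Longrightarrow> v = Im (fst v) *\<^sub>R hI + Re (snd v) *\<^sub>R hJ + Im (snd v) *\<^sub>R hK"
  by (simp add: hI_def hJ_def hK_def prod_eq_iff complex_eq_iff)

text \<open>The inner product of the orthogonal projections of \<open>a\<close> and \<open>b\<close> to the horizontal space at a
  unit vector \<open>q\<close>.\<close>

definition horiz_form :: "'n::finite hvec \<Rightarrow> 'n hvec \<Rightarrow> 'n hvec \<Rightarrow> real" where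
  "horiz_form q a b = a \<bullet> b - (a \<bullet> q) * (b \<bullet> q) - (qact hI a \<bullet> q) * (qact hI b \<bullet> q)
     - (qact hJ a \<bullet> q) * (qact hJ b \<bullet> q) - (qact hK a \<bullet> q) * (qact hK b \<bullet> q)"

lemma subspace_horizontal: "subspace (horizontal q)"
  unfolding subspace_def horizontal_def by (auto simp: inner_left_distrib)

lemma horizontal_frame_exists:
  obtains B where "horizontal_frame q B"
  using orthonormal_basis_subspace[OF subspace_horizontal[of q]] unfolding horizontal_frame_def by metis

lemma horizontal_iff:
  "e \<in> horizontal q \<longleftrightarrow> e \<bullet> q = 0 \<and> e \<bullet> qact hI q = 0 \<and> e \<bullet> qact hJ q = 0 \<and> e \<bullet> qact hK q = 0"
proof -
  have "e \<bullet> qact v q = 0"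
    if "e \<bullet> qact hI q = 0" "e \<bullet> qact hJ q = 0" "e \<bullet> qact hK q = 0" "Re (fst v) = 0" for v
    using that by (subst imaginary_expansion) (simp_all add: qact_add_left qact_scaleR_left inner_add_right)
  then show ?thesis unfolding horizontal_def mem_Collect_eq using units_imaginary by blast
qed

lemma frame_finite: "horizontal_frame q B \<Longrightarrow> finite B"
  unfolding horizontal_frame_def
  by (metis independent_imp_finite norm_zero pairwise_orthogonal_independent zero_neq_one)

lemma frame_subset: "horizontal_frame q B \<Longrightarrow> e \<in> B \<Longrightarrow> e \<in> horizontal q"
  unfolding horizontal_frame_def by (metis span_base)

lemma frame_inner:
  "horizontal_frame q B \<Longrightarrow> e \<in> B \<Longrightarrow> e' \<in> B \<Longrightarrow> e \<bullet> e' = (if e = e' then 1 else 0)"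
  unfolding horizontal_frame_def pairwise_def orthogonal_def by (auto simp: norm_eq_1)

lemma frame_expansion:
  assumes B: "horizontal_frame q B" and x: "x \<in> horizontal q"
  shows "x = (\<Sum>e\<in>B. (x \<bullet> e) *\<^sub>R e)"
proof -
  note fin = frame_finite[OF B]
  have "x \<in> range (\<lambda>u. \<Sum>e\<in>B. u e *\<^sub>R e)"
    using x B unfolding horizontal_frame_def span_finite[OF fin] by simp
  then obtain u where u: "x = (\<Sum>e\<in>B. u e *\<^sub>R e)" by blast
  have "x \<bullet> e = u e" if "e \<in> B" for e
    unfolding u using that fin by (simp add: inner_sum_left frame_inner[OF B] if_distrib cong: if_cong)
  then show ?thesis using u by simp
qed

text \<open>For a unit vector \<open>q\<close>, the vectors \<open>q\<close>,
  \<open>qact hI q\<close>, \<open>qact hJ q\<close>, \<open>qact hK q\<close> are orthonormal and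
  orthogonal to the frame. Removing their components from \<open>a\<close> gives a horizontal vector
  \<open>a'\<close> with the same frame coefficients, and expanding \<open>a'\<close> in the frame
  yields a value in which the frame no longer occurs.\<close>

lemma frame_sum:
  assumes B: "horizontal_frame q B" and q: "norm q = 1"
  shows "(\<Sum>e\<in>B. (a \<bullet> e) * (b \<bullet> e)) = horiz_form q a b"
proof -
  have qq: "q \<bullet> q = 1" using q by (simp add: norm_eq_1)
  have un: "qact hI q \<bullet> qact hI q = 1" "qact hJ q \<bullet> qact hJ q = 1" "qact hK q \<bullet> qact hK q = 1"
    by (simp_all add: qact_inner norm_units qq)
  have z: "q \<bullet> qact hI q = 0" "q \<bullet> qact hJ q = 0" "q \<bullet> qact hK q = 0"
    "qact hI q \<bullet> q = 0" "qact hJ q \<bullet> q = 0" "qact hK q \<bullet> q = 0"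
    by (simp_all add: inner_qact_self units_imaginary inner_commute[of "qact _ q" q])
  \<comment> \<open>Moving one unit across the inner product by skewness leaves the product of two
    distinct units, which is again imaginary, and \<open>q\<close> is orthogonal to the image of
    \<open>q\<close> under an imaginary quaternion.\<close>
  have "qact hI q \<bullet> qact hJ q = - (qact (qmult hJ hI) q \<bullet> q)"
       "qact hI q \<bullet> qact hK q = - (qact (qmult hK hI) q \<bullet> q)"
       "qact hJ q \<bullet> qact hK q = - (qact (qmult hK hJ) q \<bullet> q)"
    by (simp_all add: qact_skew units_imaginary qact_qact)
  moreover have "Re (fst (qmult hJ hI)) = 0" "Re (fst (qmult hK hI)) = 0" "Re (fst (qmult hK hJ)) = 0"
    by (simp_all add: hI_def hJ_def hK_def qmult_def)
  ultimately have o: "qact hI q \<bullet> qact hJ q = 0" "qact hI q \<bullet> qact hK q = 0" "qact hJ q \<bullet> qact hK q = 0"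
    using inner_qact_self by (metis inner_commute neg_0_equal_iff_equal)+
  then have o': "qact hJ q \<bullet> qact hI q = 0" "qact hK q \<bullet> qact hI q = 0" "qact hK q \<bullet> qact hJ q = 0"
    by (simp_all add: inner_commute)
  define a' where "a' = a - (a \<bullet> q) *\<^sub>R q - (a \<bullet> qact hI q) *\<^sub>R qact hI q
      - (a \<bullet> qact hJ q) *\<^sub>R qact hJ q - (a \<bullet> qact hK q) *\<^sub>R qact hK q"
  have a': "a' \<in> horizontal q"
    unfolding horizontal_iff a'_def
    by (simp add: inner_diff_left z un qq o o')
  have "a \<bullet> e = a' \<bullet> e" if "e \<in> B" for e
    using frame_subset[OF B that] unfolding horizontal_iff a'_def
    by (simp add: inner_diff_right inner_commute[of _ e])
  then have "(\<Sum>e\<in>B. (a \<bullet> e) * (b \<bullet> e)) = b \<bullet> (\<Sum>e\<in>B. (a' \<bullet> e) *\<^sub>R e)"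
    by (simp add: inner_sum_right)
  also have "\<dots> = b \<bullet> a'" using frame_expansion[OF B a'] by simp
  also have "\<dots> = horiz_form q a b"
    by (simp add: a'_def horiz_form_def inner_diff_right inner_add_right qact_skew units_imaginary
        inner_commute[of b a] inner_commute[of b q])
  finally show ?thesis .
qed

text \<open>The trace of the horizontal projection, computed once in the frame and once in the
  standard basis. In the latter \<open>q\<close> and its three vertical companions, being unit
  vectors, take away one each.\<close>

lemma frame_card:
  assumes B: "horizontal_frame q B" and q: "norm (q :: 'n::finite hvec) = 1"
  shows "real (card B) = real DIM('n hvec) - 4"
proof -
  have qq: "q \<bullet> q = 1" using q by (simp add: norm_eq_1)
  have sq: "(\<Sum>b\<in>Basis. (x \<bullet> b) * (x \<bullet> b)) = x \<bullet> x" for x :: "'n hvec"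
    by (rule euclidean_inner[symmetric])
  have sq': "(\<Sum>b\<in>Basis. (qact v b \<bullet> q) * (qact v b \<bullet> q)) = 1"
    if "Re (fst v) = 0" "norm v = 1" for v
  proof -
    have "qact v b \<bullet> q = - (qact v q \<bullet> b)" for b
      by (simp add: inner_commute[of "qact v q" b] qact_skew[OF that(1), of b q])
    then show ?thesis using that(2) by (simp add: sq qact_inner qq)
  qed
  have sq2: "(\<Sum>b\<in>Basis. (b \<bullet> x) * (b \<bullet> x)) = x \<bullet> x" for x :: "'n hvec"
  proof -
    have "(b \<bullet> x) * (b \<bullet> x) = (x \<bullet> b) * (x \<bullet> b)" for b
      by (simp only: inner_commute[of b x])
    then show ?thesis by (simp only: sq)
  qed
  have dim: "(\<Sum>b\<in>(Basis :: 'n hvec set). b \<bullet> b) = real DIM('n hvec)"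
    by (simp add: inner_same_Basis del: DIM_prod)
  have "(\<Sum>e\<in>B. e \<bullet> e) = (\<Sum>e\<in>B. 1)"
    by (intro sum.cong refl) (use frame_inner[OF B] in auto)
  then have "real (card B) = (\<Sum>e\<in>B. e \<bullet> e)" by simp
  also have "\<dots> = (\<Sum>e\<in>B. \<Sum>b\<in>Basis. (b \<bullet> e) * (b \<bullet> e))"
    by (simp only: sq2)
  also have "\<dots> = (\<Sum>b\<in>Basis. horiz_form q b b)"
    unfolding frame_sum[OF B q, symmetric] by (rule sum.swap)
  also have "\<dots> = real DIM('n hvec) - 4"
    unfolding horiz_form_def sum_subtractf sq2 dim qq
    by (simp only: sq' units_imaginary norm_units)
  finally show ?thesis .
qed

section \<open>The circle action on horizontal spaces and frames\<close>

lemma qact_cis_horizontal: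
  assumes "e \<in> horizontal q"
  shows "qact (cis \<theta>, 0) e \<in> horizontal (qact (cis \<theta>, 0) q)"
proof -
  let ?g = "(cis \<theta>, 0) :: quat"
  have g: "norm ?g = 1" by (simp add: norm_prod_def)
  have "qact ?g e \<bullet> qact v (qact ?g q) = 0" if "Re (fst v) = 0" for v
  proof -
    \<comment> \<open>\<open>w\<close> is the conjugate of \<open>v\<close> by the circle element.
      The first component is unchanged, so \<open>w\<close> is imaginary whenever \<open>v\<close>
      is.\<close>
    define w where "w = (fst v, snd v * cis (- 2 * \<theta>))"
    have "qmult v ?g = qmult ?g w"
      by (simp add: w_def qmult_def cis_cnj cis_mult)
    then have "qact ?g e \<bullet> qact v (qact ?g q) = e \<bullet> qact w q"
      by (simp add: qact_qact[of v] qact_qact[of ?g w, symmetric] qact_inner g)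
    also have "\<dots> = 0" using assms that by (simp add: horizontal_def w_def)
    finally show ?thesis .
  qed
  then show ?thesis using assms by (simp add: horizontal_def qact_inner g)
qed

lemma qact_cis_qact_cis: "qact (cis \<alpha>, 0) (qact (cis \<beta>, 0) q) = qact (cis (\<alpha> + \<beta>), 0) q"
  by (simp add: qact_qact qmult_def cis_mult)

lemma linear_qact: "linear (qact g)"
  by (intro linearI qact_add_right qact_scaleR_right)

lemma norm_cis_pair: "norm ((cis \<theta>, 0) :: quat) = 1"
  by (simp add: norm_prod_def)

lemma norm_qact_cis: "norm (qact (cis \<theta>, 0) q) = norm q"
  by (simp only: norm_qact norm_cis_pair mult_1)

lemma inj_qact_cis: "inj (qact (cis \<theta>, 0))"
  by (rule inj_on_inverseI[of _ "qact (cis (- \<theta>), 0)"]) (simp add: qact_cis_qact_cis)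

lemma qact_cis_frame:
  assumes B: "horizontal_frame q B"
  shows "horizontal_frame (qact (cis \<theta>, 0) q) (qact (cis \<theta>, 0) ` B)"
proof -
  let ?g = "(cis \<theta>, 0) :: quat"
  have g: "norm ?g = 1" by (simp add: norm_prod_def)
  have "horizontal (qact ?g q) \<subseteq> qact ?g ` horizontal q"
  proof
    fix e assume "e \<in> horizontal (qact ?g q)"
    then have "qact (cis (- \<theta>), 0) e \<in> horizontal q"
      using qact_cis_horizontal[of e "qact ?g q" "- \<theta>"] by (simp add: qact_cis_qact_cis)
    moreover have "e = qact ?g (qact (cis (- \<theta>), 0) e)" by (simp add: qact_cis_qact_cis)
    ultimately show "e \<in> qact ?g ` horizontal q" by blast
  qed
  then have "span (qact ?g ` B) = horizontal (qact ?g q)"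
    using B qact_cis_horizontal[of _ q \<theta>]
    by (auto simp: linear_span_image[OF linear_qact] horizontal_frame_def)
  then show ?thesis
    using B unfolding horizontal_frame_def
    by (auto simp: pairwise_def orthogonal_def qact_inner g norm_qact)
qed


section \<open>The sub-Laplacian on polynomials\<close>

text \<open>\<open>k\<close> bounds the degree and \<open>c\<close> the sum of the absolute coefficients in an expansion into products of
  linear forms of norm at most \<open>1\<close>.\<close>

inductive bpoly :: "nat \<Rightarrow> real \<Rightarrow> ('n::finite hvec \<Rightarrow> real) \<Rightarrow> bool" where
  const: "\<bar>a\<bar> \<le> c \<Longrightarrow> bpoly k c (\<lambda>_. a)"
| linear: "bpoly k c f \<Longrightarrow> norm a \<le> 1 \<Longrightarrow> bpoly (Suc k) c (\<lambda>x. (a \<bullet> x) * f x)"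
| add: "bpoly k c f \<Longrightarrow> bpoly k d g \<Longrightarrow> bpoly k (c + d) (\<lambda>x. f x + g x)"

lemma bpoly_nonneg: "bpoly k c f \<Longrightarrow> 0 \<le> c"
  by (induction rule: bpoly.induct) auto

lemma bpoly_bound: "bpoly k c f \<Longrightarrow> norm x = 1 \<Longrightarrow> \<bar>f x\<bar> \<le> c"
proof (induction rule: bpoly.induct)
  case (linear k c f a)
  have "\<bar>a \<bullet> x\<bar> \<le> 1" using Cauchy_Schwarz_ineq2[of a x] linear by simp
  then have "\<bar>a \<bullet> x\<bar> * \<bar>f x\<bar> \<le> 1 * c" using linear by (intro mult_mono) auto
  then show ?case by (simp add: abs_mult)
qed auto

lemma bpoly_mono:
  "bpoly k c f \<Longrightarrow> k \<le> k' \<Longrightarrow> c \<le> c' \<Longrightarrow> bpoly k' c' f"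
proof (induction arbitrary: k' c' rule: bpoly.induct)
  case (linear k c f a)
  then obtain l where "k' = Suc l" "k \<le> l" by (cases k') auto
  with linear show ?case by (auto intro: bpoly.linear)
next
  case (add k c f d g)
  then have "bpoly k' (c + (c' - c)) (\<lambda>x. f x + g x)"
    by (intro bpoly.add) auto
  then show ?case by simp
qed (auto intro: bpoly.const)

lemma bpoly_cmult: "bpoly k c f \<Longrightarrow> bpoly k (\<bar>b\<bar> * c) (\<lambda>x. b * f x)"
proof (induction rule: bpoly.induct)
  case (const a c k)
  then show ?case by (intro bpoly.const) (simp add: abs_mult mult_left_mono)
next
  case (linear k c f a)
  then show ?case using bpoly.linear[of k "\<bar>b\<bar> * c" "\<lambda>x. b * f x" a] by (simp add: mult.left_commute)
next
  case (add k c f d g)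
  then show ?case using bpoly.add[of k "\<bar>b\<bar> * c" "\<lambda>x. b * f x" "\<bar>b\<bar> * d" "\<lambda>x. b * g x"]
    by (simp add: algebra_simps)
qed

lemma bpoly_inner: "bpoly k c f \<Longrightarrow> bpoly (Suc k) (norm a * c) (\<lambda>x. (a \<bullet> x) * f x)"
proof (cases "a = 0")
  case False
  assume "bpoly k c f"
  then have "bpoly (Suc k) c (\<lambda>x. (sgn a \<bullet> x) * f x)"
    by (rule bpoly.linear) (simp add: norm_sgn)
  from bpoly_cmult[OF this, of "norm a"] False show ?thesis
    by (simp add: sgn_div_norm mult.assoc[symmetric])
qed (auto intro: bpoly.const)

lemma bpoly_mult: "bpoly k c f \<Longrightarrow> bpoly l d g \<Longrightarrow> bpoly (k + l) (c * d) (\<lambda>x. f x * g x)"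
proof (induction rule: bpoly.induct)
  case (const a c k)
  then show ?case
    by (intro bpoly_mono[OF bpoly_cmult[OF const(2)]] mult_right_mono bpoly_nonneg[OF const(2)]) auto
next
  case (linear k c f a)
  then show ?case using bpoly.linear[of "k + l" "c * d" "\<lambda>x. f x * g x" a] by (simp add: mult.assoc)
next
  case (add k c f e h)
  then show ?case using bpoly.add[of "k + l" "c * d" "\<lambda>x. f x * g x" "e * d" "\<lambda>x. h x * g x"]
    by (simp add: algebra_simps)
qed

lemma bpoly_imp_polynomial: "bpoly k c f \<Longrightarrow> real_polynomial_function f"
  by (induction rule: bpoly.induct)
     (simp_all only: real_polynomial_function.intros(2-4) real_polynomial_function.intros(1)[OF bounded_linear_inner_right])

lemma polynomial_imp_bpoly: "real_polynomial_function f \<Longrightarrow> \<exists>k c. bpoly k c f"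
proof (induction rule: real_polynomial_function.induct)
  case (linear f)
  then interpret bounded_linear f .
  define a where "a = (\<Sum>b\<in>Basis. f b *\<^sub>R b)"
  have "f x = (a \<bullet> x) * 1" for x
    by (subst euclidean_representation[of x, symmetric], subst sum)
       (simp add: scaleR a_def inner_sum_left inner_sum_right inner_commute mult.commute)
  then show ?case using bpoly_inner[OF bpoly.const[of 1 1 0], of a] by auto
next
  case (const a)
  then show ?case using bpoly.const by blast
next
  case (add f g)
  then obtain k c l d where "bpoly k c f" "bpoly l d g" by blast
  then have "bpoly (max k l) c f" "bpoly (max k l) d g" by (auto intro: bpoly_mono)
  then show ?case using bpoly.add by blast
next
  case (mult f g)
  then show ?case using bpoly_mult by blast
qed

text \<open>A two-jet at 0, stated as a relation so that the sum and product rules need no separate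
  differentiability conditions. The first derivative is demanded at every \<open>s\<close>, since
  the iterated \<open>deriv\<close> differentiates it as a function.\<close>

definition second_order :: "(real \<Rightarrow> real) \<Rightarrow> real \<Rightarrow> real \<Rightarrow> bool" where
  "second_order g D1 D2 \<longleftrightarrow> (\<exists>g'. (\<forall>s. (g has_field_derivative g' s) (at s)) \<and> g' 0 = D1 \<and>
     (g' has_field_derivative D2) (at 0))"

lemma second_order_deriv:
  assumes "second_order g D1 D2"
  shows "(deriv ^^ 2) g 0 = D2"
proof -
  obtain g' where g': "\<And>s. (g has_field_derivative g' s) (at s)" "(g' has_field_derivative D2) (at 0)"
    using assms unfolding second_order_def by blast
  then have "deriv g = g'" using DERIV_imp_deriv by blast
  with g' show ?thesis by (simp add: numeral_2_eq_2 DERIV_imp_deriv)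
qed

lemma second_order_const: "second_order (\<lambda>_. a) 0 0"
  unfolding second_order_def by (intro exI[of _ "\<lambda>_. 0"]) auto

lemma second_order_add:
  "second_order f a b \<Longrightarrow> second_order g c d \<Longrightarrow> second_order (\<lambda>s. f s + g s) (a + c) (b + d)"
  unfolding second_order_def
  apply (elim exE conjE)
  subgoal for f' g' by (intro exI[of _ "\<lambda>s. f' s + g' s"]) (auto intro!: derivative_eq_intros)
  done

lemma second_order_mult:
  "second_order f a b \<Longrightarrow> second_order g c d \<Longrightarrow>
    second_order (\<lambda>s. f s * g s) (a * g 0 + f 0 * c) (b * g 0 + 2 * (a * c) + f 0 * d)"
  unfolding second_order_def
  apply (elim exE conjE)
  subgoal for f' g'
    by (intro exI[of _ "\<lambda>s. f' s * g s + f s * g' s"])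
       (force intro!: derivative_eq_intros simp: algebra_simps)
  done

lemma second_order_trig: "second_order (\<lambda>s. cos s * a + sin s * b) b (- a)"
  unfolding second_order_def
  by (intro exI[of _ "\<lambda>s. - sin s * a + cos s * b"]) (auto intro!: derivative_eq_intros)

text \<open>Built to satisfy the recurrence of the product rule: one more linear factor adds at most
  the ambient dimension, from the second derivative of that factor, and \<open>10 * real k\<close>,
  from twice the first-order trace of size \<open>5 * real k\<close>.\<close>

definition growth_const :: "'n::finite itself \<Rightarrow> nat \<Rightarrow> real" where
  "growth_const _ k = real k * (real DIM('n hvec) + 10 * real k)"

text \<open>\<open>horiz_form\<close> has five terms, each a product of at most two linear forms of
  norm at most 1 in \<open>q\<close> with a constant of absolute value at most 1. This is the origin
  of the constant 5.\<close>

lemma bpoly_horiz_form: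
  assumes f: "bpoly k c f" and a: "norm a \<le> 1" and b: "norm b \<le> 1"
  shows "bpoly (Suc (Suc k)) (5 * c) (\<lambda>q. horiz_form q a b * f q)"
proof -
  have lin2: "bpoly (Suc (Suc k)) c (\<lambda>q. x * ((v \<bullet> q) * ((w \<bullet> q) * f q)))"
    if "norm v \<le> 1" "norm w \<le> 1" "x \<in> {1, -1}" for v w x
    using bpoly_cmult[OF bpoly.linear[OF bpoly.linear[OF f that(2)] that(1)], of x] that(3) by auto
  have ab: "bpoly (Suc (Suc k)) c (\<lambda>q. (a \<bullet> b) * f q)"
  proof (rule bpoly_mono[OF bpoly_cmult[OF f]])
    have "\<bar>a \<bullet> b\<bar> \<le> 1" using Cauchy_Schwarz_ineq2[of a b] mult_mono[OF a b] by simp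
    then show "\<bar>a \<bullet> b\<bar> * c \<le> c" using bpoly_nonneg[OF f] by (simp add: mult_left_le_one_le)
  qed simp
  have u: "norm (qact hI a) \<le> 1" "norm (qact hJ a) \<le> 1" "norm (qact hK a) \<le> 1"
    "norm (qact hI b) \<le> 1" "norm (qact hJ b) \<le> 1" "norm (qact hK b) \<le> 1"
    using a b by (simp_all add: norm_qact norm_units)
  let ?F = "\<lambda>q. ((((a \<bullet> b) * f q + -1 * ((a \<bullet> q) * ((b \<bullet> q) * f q)))
     + -1 * ((qact hI a \<bullet> q) * ((qact hI b \<bullet> q) * f q))) + -1 * ((qact hJ a \<bullet> q) * ((qact hJ b \<bullet> q) * f q)))
     + -1 * ((qact hK a \<bullet> q) * ((qact hK b \<bullet> q) * f q))"
  have "bpoly (Suc (Suc k)) ((((c + c) + c) + c) + c) ?F"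
    by (intro bpoly.add lin2 ab a b u) auto
  moreover have "?F = (\<lambda>q. horiz_form q a b * f q)"
    by (rule ext) (simp add: horiz_form_def algebra_simps)
  moreover have "(((c + c) + c) + c) + c = 5 * c" by simp
  ultimately show ?thesis by simp
qed

text \<open>Since \<open>X\<close> sees only \<open>q\<close>, the relation includes independence of
  the frame, which is what later removes the choice of a frame from the operators.\<close>

definition horiz_trace :: "('n::finite hvec \<Rightarrow> 'n hvec \<Rightarrow> real) \<Rightarrow> ('n hvec \<Rightarrow> real) \<Rightarrow> bool" where
  "horiz_trace F X \<longleftrightarrow> (\<forall>q B. norm q = 1 \<longrightarrow> horizontal_frame q B \<longrightarrow> (\<Sum>e\<in>B. F q e) = X q)"

lemma horiz_traceI:
  "(\<And>q B. norm q = 1 \<Longrightarrow> horizontal_frame q B \<Longrightarrow> (\<Sum>e\<in>B. F q e) = X q) \<Longrightarrow> horiz_trace F X"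
  and horiz_traceD:
  "horiz_trace F X \<Longrightarrow> norm q = 1 \<Longrightarrow> horizontal_frame q B \<Longrightarrow> (\<Sum>e\<in>B. F q e) = X q"
  unfolding horiz_trace_def by blast+

lemma horiz_trace_add:
  "horiz_trace F X \<Longrightarrow> horiz_trace G Y \<Longrightarrow> horiz_trace (\<lambda>q e. F q e + G q e) (\<lambda>q. X q + Y q)"
  by (simp add: horiz_trace_def sum.distrib)

lemma horiz_trace_0: "horiz_trace (\<lambda>_ _. 0) (\<lambda>_. 0)"
  by (simp add: horiz_trace_def)

text \<open>The two traces over a horizontal frame, of \<open>a \<otimes> df\<close> and of the Hessian of \<open>f\<close>, are treated
  together because the second one recurses through the first.\<close>

lemma bpoly_traces:
  fixes f :: "'n::finite hvec \<Rightarrow> real"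
  assumes "bpoly k c f"
  shows "\<exists>D1 D2. (\<forall>q e. second_order (\<lambda>s. f (great_circle q e s)) (D1 q e) (D2 q e)) \<and>
    (\<forall>a. norm a \<le> 1 \<longrightarrow> (\<exists>X. bpoly (Suc k) (5 * real k * c) X \<and>
      horiz_trace (\<lambda>q e. (a \<bullet> e) * D1 q e) X)) \<and>
    (\<exists>Y. bpoly k (growth_const TYPE('n) k * c) Y \<and>
      horiz_trace (\<lambda>q e. D2 q e) Y)"
  using assms
proof (induction rule: bpoly.induct)
  case (const x c k)
  have "0 \<le> growth_const TYPE('n) k * c" "0 \<le> 5 * real k * c"
    using const by (auto simp: growth_const_def)
  then have "bpoly (Suc k) (5 * real k * c) (\<lambda>_::'n hvec. 0)" "bpoly k (growth_const TYPE('n) k * c) (\<lambda>_::'n hvec. 0)"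
    by (auto intro: bpoly.const)
  then show ?case
    by (intro exI[of _ "\<lambda>_ _. 0"]) (auto intro: second_order_const horiz_trace_0)
next
  case (add k c f d g)
  from add.IH(1) obtain D1 D2 where f: "\<And>q e. second_order (\<lambda>s. f (great_circle q e s)) (D1 q e) (D2 q e)"
    "\<And>a. norm a \<le> 1 \<Longrightarrow> \<exists>X. bpoly (Suc k) (5 * real k * c) X \<and>
      horiz_trace (\<lambda>q e. (a \<bullet> e) * D1 q e) X"
    "\<exists>Y. bpoly k (growth_const TYPE('n) k * c) Y \<and>
      horiz_trace (\<lambda>q e. D2 q e) Y" by blast
  from add.IH(2) obtain E1 E2 where g: "\<And>q e. second_order (\<lambda>s. g (great_circle q e s)) (E1 q e) (E2 q e)"
    "\<And>a. norm a \<le> 1 \<Longrightarrow> \<exists>X. bpoly (Suc k) (5 * real k * d) X \<and>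
      horiz_trace (\<lambda>q e. (a \<bullet> e) * E1 q e) X"
    "\<exists>Y. bpoly k (growth_const TYPE('n) k * d) Y \<and>
      horiz_trace (\<lambda>q e. E2 q e) Y" by blast
  have X: "\<exists>X. bpoly (Suc k) (5 * real k * (c + d)) X \<and>
      horiz_trace (\<lambda>q e. (a \<bullet> e) * (D1 q e + E1 q e)) X"
    if "norm a \<le> 1" for a
  proof -
    from f(2)[OF that] obtain X where X: "bpoly (Suc k) (5 * real k * c) X"
      "horiz_trace (\<lambda>q e. (a \<bullet> e) * D1 q e) X" by blast
    from g(2)[OF that] obtain Z where Z: "bpoly (Suc k) (5 * real k * d) Z"
      "horiz_trace (\<lambda>q e. (a \<bullet> e) * E1 q e) Z" by blast
    have "bpoly (Suc k) (5 * real k * (c + d)) (\<lambda>q. X q + Z q)"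
      using bpoly.add[OF X(1) Z(1)] by (simp add: algebra_simps)
    then show ?thesis using horiz_trace_add[OF X(2) Z(2)]
      by (intro exI[of _ "\<lambda>q. X q + Z q"]) (simp add: distrib_left)
  qed
  from f(3) obtain X where X': "bpoly k (growth_const TYPE('n) k * c) X"
      "horiz_trace (\<lambda>q e. D2 q e) X" by blast
  from g(3) obtain Z where Z': "bpoly k (growth_const TYPE('n) k * d) Z"
      "horiz_trace (\<lambda>q e. E2 q e) Z" by blast
  have Y: "bpoly k (growth_const TYPE('n) k * (c + d)) (\<lambda>q. X q + Z q)"
    using bpoly.add[OF X'(1) Z'(1)] by (simp add: algebra_simps)
  have Y': "\<exists>Y. bpoly k (growth_const TYPE('n) k * (c + d)) Y \<and>
      horiz_trace (\<lambda>q e. D2 q e + E2 q e) Y"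
    using Y horiz_trace_add[OF X'(2) Z'(2)] by blast
  show ?case
    by (rule exI[of _ "\<lambda>q e. D1 q e + E1 q e"], rule exI[of _ "\<lambda>q e. D2 q e + E2 q e"], intro conjI allI impI)
       (rule second_order_add[OF f(1) g(1)], erule X, rule Y')
next
  case (linear k c f b)
  note b = \<open>norm b \<le> 1\<close>
  from linear.IH obtain D1 D2 where so: "\<And>q e. second_order (\<lambda>s. f (great_circle q e s)) (D1 q e) (D2 q e)"
    and IX: "\<And>a. norm a \<le> 1 \<Longrightarrow> \<exists>X. bpoly (Suc k) (5 * real k * c) X \<and>
      horiz_trace (\<lambda>q e. (a \<bullet> e) * D1 q e) X"
    and IY: "\<exists>Y. bpoly k (growth_const TYPE('n) k * c) Y \<and>
      horiz_trace (\<lambda>q e. D2 q e) Y" by blast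
  have c: "c \<ge> 0" using linear.hyps bpoly_nonneg by blast
  \<comment> \<open>Leibniz' rule along the great circle: the linear form has derivatives
    \<open>b \<bullet> e\<close> and \<open>- (b \<bullet> q)\<close> at 0, the second because the
    position vector \<open>\<gamma>\<close> of a great circle satisfies
    \<open>\<gamma>'' = - \<gamma>\<close>.\<close>
  define E1 where "E1 q e = (b \<bullet> e) * f q + (b \<bullet> q) * D1 q e" for q e
  define E2 where "E2 q e = - (b \<bullet> q) * f q + 2 * ((b \<bullet> e) * D1 q e) + (b \<bullet> q) * D2 q e" for q e
  have gc0: "great_circle q e 0 = q" for q e :: "'n hvec" by (simp add: great_circle_def)
  have inn: "(\<lambda>s. b \<bullet> great_circle q e s) = (\<lambda>s. cos s * (b \<bullet> q) + sin s * (b \<bullet> e))" for q e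
    by (simp add: great_circle_def inner_add_right)
  have 1: "second_order (\<lambda>s. (b \<bullet> great_circle q e s) * f (great_circle q e s)) (E1 q e) (E2 q e)" for q e
    using second_order_mult[OF second_order_trig[of "b \<bullet> q" "b \<bullet> e", folded inn] so[of q e]]
    by (simp add: gc0 E1_def E2_def)
  have 2: "\<exists>X. bpoly (Suc (Suc k)) (5 * real (Suc k) * c) X \<and>
      horiz_trace (\<lambda>q e. (a \<bullet> e) * E1 q e) X"
    if a: "norm a \<le> 1" for a
  proof -
    from IX[OF a] obtain X where X: "bpoly (Suc k) (5 * real k * c) X"
      "horiz_trace (\<lambda>q e. (a \<bullet> e) * D1 q e) X" by blast
    have "bpoly (Suc (Suc k)) (5 * real (Suc k) * c) (\<lambda>q. horiz_form q a b * f q + (b \<bullet> q) * X q)"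
      using bpoly.add[OF bpoly_horiz_form[OF linear.hyps(1) a b] bpoly.linear[OF X(1) b]]
      by (simp add: algebra_simps)
    moreover have "(\<Sum>e\<in>B. (a \<bullet> e) * E1 q e) = horiz_form q a b * f q + (b \<bullet> q) * X q"
      if "norm q = 1" "horizontal_frame q B" for q B
      unfolding frame_sum[OF that(2,1), symmetric] horiz_traceD[OF X(2) that, symmetric] E1_def
      by (simp add: sum.distrib sum_distrib_left sum_distrib_right algebra_simps)
    ultimately show ?thesis by (intro exI[of _ "\<lambda>q. horiz_form q a b * f q + (b \<bullet> q) * X q"] conjI horiz_traceI)
  qed
  from IX[OF b] obtain X where X: "bpoly (Suc k) (5 * real k * c) X"
      "horiz_trace (\<lambda>q e. (b \<bullet> e) * D1 q e) X" by blast
  from IY obtain Y where Y: "bpoly k (growth_const TYPE('n) k * c) Y"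
      "horiz_trace (\<lambda>q e. D2 q e) Y" by blast
  \<comment> \<open>\<open>m\<close> is the number of frame vectors: the term
    \<open>- (b \<bullet> q) * f q\<close> of \<open>E2\<close> is the same for each of them. The
    cross term is the first-order trace taken at \<open>b\<close> itself, and its degree
    \<open>Suc k\<close> equals that of the product.\<close>
  define m where "m = real DIM('n hvec) - 4"
  have m: "0 \<le> m" "m \<le> real DIM('n hvec)" by (simp_all add: m_def)
  let ?Z = "\<lambda>q. ((- m) * ((b \<bullet> q) * f q) + 2 * X q) + (b \<bullet> q) * Y q"
  have "bpoly (Suc k) ((\<bar>- m\<bar> * c + \<bar>2\<bar> * (5 * real k * c)) + growth_const TYPE('n) k * c) ?Z"
    using b by (intro bpoly.add bpoly.linear bpoly_cmult X Y linear.hyps)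
  then have 3: "bpoly (Suc k) (growth_const TYPE('n) (Suc k) * c) ?Z"
  proof (rule bpoly_mono)
    have "m + 10 * real k + growth_const TYPE('n) k \<le> growth_const TYPE('n) (Suc k)"
      using m by (simp add: growth_const_def algebra_simps)
    from mult_right_mono[OF this c]
    show "(\<bar>- m\<bar> * c + \<bar>2\<bar> * (5 * real k * c)) + growth_const TYPE('n) k * c \<le> growth_const TYPE('n) (Suc k) * c"
      using m(1) by (simp add: algebra_simps)
  qed simp
  have 4: "(\<Sum>e\<in>B. E2 q e) = ?Z q" if "norm q = 1" "horizontal_frame q B" for q B
    unfolding horiz_traceD[OF X(2) that, symmetric] horiz_traceD[OF Y(2) that, symmetric] E2_def m_def
      frame_card[OF that(2,1), symmetric]
    by (simp add: sum.distrib sum_distrib_left sum_subtractf sum_negf)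
  have 5: "\<exists>Y. bpoly (Suc k) (growth_const TYPE('n) (Suc k) * c) Y \<and>
      horiz_trace (\<lambda>q e. E2 q e) Y"
    using 3 4 by (intro exI[of _ ?Z] conjI horiz_traceI)
  show ?case
    by (rule exI[of _ E1], rule exI[of _ E2], intro conjI allI impI) (rule 1, erule 2, rule 5)
qed

lemma bpoly_sphere_subLaplacian:
  fixes f :: "'n::finite hvec \<Rightarrow> real"
  assumes "bpoly k c f"
  obtains Y where "bpoly k (growth_const TYPE('n) k * c) Y"
    "\<And>q B. norm q = 1 \<Longrightarrow> horizontal_frame q B \<Longrightarrow>
      (\<Sum>e\<in>B. (deriv ^^ 2) (\<lambda>s. f (great_circle q e s)) 0) = Y q"
proof -
  from bpoly_traces[OF assms] obtain D1 D2 Y where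
    D: "\<And>q e. second_order (\<lambda>s. f (great_circle q e s)) (D1 q e) (D2 q e)"
    and Y: "bpoly k (growth_const TYPE('n) k * c) Y" "horiz_trace D2 Y"
    by blast
  show ?thesis
    using that[OF Y(1)] horiz_traceD[OF Y(2)] unfolding second_order_deriv[OF D] by blast
qed


section \<open>Smoothness, and the semigroups on polynomials\<close>

lemma Ck_on_cong:
  assumes "open U" "Ck_on k U f" "\<And>x. x \<in> U \<Longrightarrow> f x = g x"
  shows "Ck_on k U g"
  using assms
proof (induction k arbitrary: f g)
  case 0
  then show ?case by (simp cong: continuous_on_cong)
next
  case (Suc k)
  have der: "(f has_derivative D) (at x) \<longleftrightarrow> (g has_derivative D) (at x)" if "x \<in> U" for x D
    by (metis Suc.prems(1,3) has_derivative_transform_within_open that)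
  have "g differentiable_on U"
    using Suc.prems by (simp add: differentiable_on_def)
      (metis differentiable_transform_within zero_less_one Suc.prems(3))
  moreover have "frechet_derivative g (at x) v = frechet_derivative f (at x) v" if "x \<in> U" for x v
    unfolding frechet_derivative_def der[OF that] ..
  then have "Ck_on k U (\<lambda>x. frechet_derivative g (at x) v)" for v
    using Suc.IH[OF Suc.prems(1), of "\<lambda>x. frechet_derivative f (at x) v"] Suc.prems(2) by simp
  ultimately show ?case by simp
qed

text \<open>An algebra of functions on the punctured space that is stable under directional derivatives
  and contains the radial extensions of polynomials.\<close>

inductive ray_fun :: "('a::euclidean_space \<Rightarrow> real) \<Rightarrow> bool" where
  const: "ray_fun (\<lambda>_. a)"
| inner: "ray_fun (\<lambda>x. x \<bullet> a)"
| inverse_norm: "ray_fun (\<lambda>x. inverse (norm x))"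
| add: "ray_fun f \<Longrightarrow> ray_fun g \<Longrightarrow> ray_fun (\<lambda>x. f x + g x)"
| mult: "ray_fun f \<Longrightarrow> ray_fun g \<Longrightarrow> ray_fun (\<lambda>x. f x * g x)"

lemma ray_fun_derivative:
  fixes f :: "'a::euclidean_space \<Rightarrow> real"
  assumes "ray_fun f"
  shows "\<exists>D. (\<forall>x. x \<noteq> 0 \<longrightarrow> (f has_derivative (\<lambda>v. D v x)) (at x)) \<and> (\<forall>v. ray_fun (D v))"
  using assms
proof (induction rule: ray_fun.induct)
  case (const a)
  then show ?case by (intro exI[of _ "\<lambda>_ _. 0"]) (auto intro: ray_fun.const)
next
  case (inner a)
  then show ?case
    by (intro exI[of _ "\<lambda>v _. v \<bullet> a"]) (auto intro!: ray_fun.const derivative_eq_intros)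
next
  case inverse_norm
  \<comment> \<open>The directional derivative of the inverse norm is
    \<open>- (x \<bullet> v) / norm x ^ 3\<close>, written as a product of generators of the
    algebra.\<close>
  let ?D = "\<lambda>v x::'a. (- 1) * ((x \<bullet> v) * (inverse (norm x) * (inverse (norm x) * inverse (norm x))))"
  have "((\<lambda>x. inverse (norm x)) has_derivative (\<lambda>v. ?D v x)) (at x)" if "x \<noteq> 0" for x :: 'a
    by (rule has_derivative_eq_rhs[OF Deriv.has_derivative_inverse[OF _ has_derivative_norm[OF that]]])
       (use that in \<open>auto simp: fun_eq_iff sgn_div_norm divide_inverse inner_commute\<close>)
  moreover have "ray_fun (?D v)" for v
    by (intro ray_fun.intros)
  ultimately show ?case by (intro exI[of _ ?D]) blast
next
  case (add f g)
  then obtain D E where "\<And>x. x \<noteq> 0 \<Longrightarrow> (f has_derivative (\<lambda>v. D v x)) (at x)" "\<And>v. ray_fun (D v)"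
    "\<And>x. x \<noteq> 0 \<Longrightarrow> (g has_derivative (\<lambda>v. E v x)) (at x)" "\<And>v. ray_fun (E v)" by blast
  then show ?case
    by (intro exI[of _ "\<lambda>v x. D v x + E v x"]) (auto intro!: ray_fun.add derivative_intros)
next
  case (mult f g)
  then obtain D E where "\<And>x. x \<noteq> 0 \<Longrightarrow> (f has_derivative (\<lambda>v. D v x)) (at x)" "\<And>v. ray_fun (D v)"
    "\<And>x. x \<noteq> 0 \<Longrightarrow> (g has_derivative (\<lambda>v. E v x)) (at x)" "\<And>v. ray_fun (E v)" by blast
  with mult.hyps show ?case
    by (intro exI[of _ "\<lambda>v x. f x * E v x + D v x * g x"])
       (auto intro!: ray_fun.add ray_fun.mult has_derivative_mult)
qed

lemma ray_fun_Ck: "ray_fun f \<Longrightarrow> Ck_on k (- {0}) f"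
proof (induction k arbitrary: f)
  case 0
  obtain D where "\<And>x. x \<noteq> 0 \<Longrightarrow> (f has_derivative (\<lambda>v. D v x)) (at x)"
    using ray_fun_derivative[OF 0] by blast
  then show ?case
    by (auto intro!: continuous_at_imp_continuous_on dest!: has_derivative_continuous)
next
  case (Suc k)
  obtain D where D: "\<And>x. x \<noteq> 0 \<Longrightarrow> (f has_derivative (\<lambda>v. D v x)) (at x)" "\<And>v. ray_fun (D v)"
    using ray_fun_derivative[OF Suc.prems] by blast
  have "f differentiable_on - {0}"
    using D(1) by (auto simp: differentiable_on_def differentiable_def intro: has_derivative_at_withinI)
  moreover have "Ck_on k (- {0}) (\<lambda>x. frechet_derivative f (at x) v)" for v
    by (rule Ck_on_cong[OF _ Suc.IH[OF D(2), of v]])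
       (use frechet_derivative_at[OF D(1)] in \<open>auto dest: fun_cong\<close>)
  ultimately show ?case by simp
qed

lemma polynomial_ray_fun:
  fixes f :: "'a::euclidean_space \<Rightarrow> real"
  shows "real_polynomial_function f \<Longrightarrow> ray_fun (\<lambda>x. f (sgn x))"
proof (induction rule: real_polynomial_function.induct)
  case (linear f)
  then interpret bounded_linear f .
  have f: "f x = x \<bullet> (\<Sum>b\<in>Basis. f b *\<^sub>R b)" for x
    by (subst euclidean_representation[of x, symmetric], subst sum)
       (simp add: scaleR inner_sum_right mult.commute)
  have "(\<lambda>x. f (sgn x)) = (\<lambda>x. inverse (norm x) * (x \<bullet> (\<Sum>b\<in>Basis. f b *\<^sub>R b)))"
    by (rule ext, subst f) (simp add: sgn_div_norm)
  then show ?case by (simp only: ray_fun.intros)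
qed (auto intro: ray_fun.intros)

text \<open>Agreement is asked on the unit sphere only, because the frame sums are known to be
  polynomial only there; otherwise the notion would not be stable under the sub-Laplacian.\<close>

definition sphere_poly :: "nat \<Rightarrow> real \<Rightarrow> ('n::finite hvec \<Rightarrow> real) \<Rightarrow> bool" where
  "sphere_poly k c f \<longleftrightarrow> (\<exists>g. bpoly k c g \<and> (\<forall>q. norm q = 1 \<longrightarrow> f q = g q))"

lemma sphere_poly_bound: "sphere_poly k c f \<Longrightarrow> norm q = 1 \<Longrightarrow> \<bar>f q\<bar> \<le> c"
  unfolding sphere_poly_def using bpoly_bound by fastforce

lemma smooth_imp_cont: "f \<in> sphere_smooth \<Longrightarrow> f \<in> sphere_cont"
proof -
  assume "f \<in> sphere_smooth"
  then have "Ck_on 0 (- {0}) (\<lambda>x. f (sgn x))" unfolding sphere_smooth_def by blast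
  then have "continuous_on hsphere (\<lambda>x. f (sgn x))"
    by (auto intro: continuous_on_subset)
  then show ?thesis
    unfolding sphere_cont_def mem_Collect_eq by (rule continuous_on_eq) (simp add: sgn_div_norm)
qed

lemma sphere_poly_smooth:
  assumes "sphere_poly k c f"
  shows "f \<in> sphere_smooth"
proof -
  obtain g where g: "bpoly k c g" "\<And>q. norm q = 1 \<Longrightarrow> f q = g q"
    using assms unfolding sphere_poly_def by blast
  have "Ck_on j (- {0}) (\<lambda>x. f (sgn x))" for j
    by (rule Ck_on_cong[OF _ ray_fun_Ck[OF polynomial_ray_fun[OF bpoly_imp_polynomial[OF g(1)]]]])
       (auto simp: g(2) norm_sgn)
  then show ?thesis unfolding sphere_smooth_def by blast
qed

lemma norm_great_circle:
  assumes "norm q = 1" "norm e = 1" "e \<in> horizontal q"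
  shows "norm (great_circle q e s) = 1"
proof -
  have "q \<bullet> q = 1" "e \<bullet> e = 1" "e \<bullet> q = 0" "q \<bullet> e = 0"
    using assms by (auto simp: norm_eq_1 horizontal_def inner_commute)
  then show ?thesis
    by (simp add: norm_eq_1 great_circle_def inner_add_left inner_add_right power2_eq_square[symmetric])
qed

text \<open>A great circle with unit horizontal velocity stays on the sphere, so along it
  \<open>f\<close> may be replaced by its polynomial representative. For the latter the frame sum
  does not depend on the frame, so any frame may be used in place of the chosen one.\<close>

lemma sphere_poly_subLaplacian:
  fixes f :: "'n::finite hvec \<Rightarrow> real"
  assumes "sphere_poly k c f"
  shows "sphere_poly k (growth_const TYPE('n) k * c) (sphere_subLaplacian f)"
    and "norm q = 1 \<Longrightarrow> horizontal_frame q B \<Longrightarrow>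
      sphere_subLaplacian f q = (\<Sum>e\<in>B. (deriv ^^ 2) (\<lambda>s. f (great_circle q e s)) 0)"
proof -
  obtain g where g: "bpoly k c g" "\<And>q. norm q = 1 \<Longrightarrow> f q = g q"
    using assms unfolding sphere_poly_def by blast
  obtain Y where Y: "bpoly k (growth_const TYPE('n) k * c) Y"
    "\<And>q B. norm q = 1 \<Longrightarrow> horizontal_frame q B \<Longrightarrow>
      (\<Sum>e\<in>B. (deriv ^^ 2) (\<lambda>s. g (great_circle q e s)) 0) = Y q"
    using bpoly_sphere_subLaplacian[OF g(1)] by blast
  have *: "(\<Sum>e\<in>B. (deriv ^^ 2) (\<lambda>s. f (great_circle q e s)) 0) = Y q"
    if "norm q = 1" "horizontal_frame q B" for q B
  proof -
    have "(\<lambda>s. f (great_circle q e s)) = (\<lambda>s. g (great_circle q e s))" if "e \<in> B" for e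
      using norm_great_circle[OF \<open>norm q = 1\<close>] frame_subset \<open>horizontal_frame q B\<close> that g(2)
      unfolding horizontal_frame_def by blast
    then show ?thesis using Y(2)[OF that] by (simp cong: sum.cong)
  qed
  have L: "sphere_subLaplacian f q = Y q" if "norm q = 1" for q
    unfolding sphere_subLaplacian_def
    by (rule *[OF that]) (rule someI_ex, metis horizontal_frame_exists)
  show "sphere_poly k (growth_const TYPE('n) k * c) (sphere_subLaplacian f)"
    unfolding sphere_poly_def using Y(1) L by blast
  show "norm q = 1 \<Longrightarrow> horizontal_frame q B \<Longrightarrow>
      sphere_subLaplacian f q = (\<Sum>e\<in>B. (deriv ^^ 2) (\<lambda>s. f (great_circle q e s)) 0)"
    using L * by simp
qed

section \<open>Circle-invariant functions and descent to the projective space\<close>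

definition circle_invariant :: "('n::finite hvec \<Rightarrow> real) \<Rightarrow> bool" where
  "circle_invariant f \<longleftrightarrow> (\<forall>\<theta> q. norm q = 1 \<longrightarrow> f (qact (cis \<theta>, 0) q) = f q)"

text \<open>The circle acts by linear isometries that map great circles to great circles and
  horizontal frames to horizontal frames. The frame at the image point may thus be taken to be the
  image frame, and the terms match one by one.\<close>

lemma sphere_subLaplacian_invariant:
  assumes f: "sphere_poly k c f" "circle_invariant f"
  shows "circle_invariant (sphere_subLaplacian f)"
  unfolding circle_invariant_def
proof (intro allI impI)
  fix \<theta> and q :: "'a hvec" assume q: "norm q = 1"
  let ?g = "qact (cis \<theta>, 0) :: 'a hvec \<Rightarrow> 'a hvec"
  obtain B where B: "horizontal_frame q B" using horizontal_frame_exists by blast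
  have gc: "great_circle (?g q) (?g e) s = ?g (great_circle q e s)" for e s
    by (simp add: great_circle_def qact_add_right qact_scaleR_right)
  have "sphere_subLaplacian f (?g q) = (\<Sum>e\<in>?g ` B. (deriv ^^ 2) (\<lambda>s. f (great_circle (?g q) e s)) 0)"
    by (rule sphere_poly_subLaplacian(2)[OF f(1)]) (simp_all add: norm_qact_cis q qact_cis_frame[OF B] del: norm_prod_def)
  also have "\<dots> = (\<Sum>e\<in>B. (deriv ^^ 2) (\<lambda>s. f (?g (great_circle q e s))) 0)"
    by (subst sum.reindex) (auto intro: inj_on_subset[OF inj_qact_cis] simp: gc)
  also have "\<dots> = (\<Sum>e\<in>B. (deriv ^^ 2) (\<lambda>s. f (great_circle q e s)) 0)"
  proof (rule sum.cong[OF refl])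
    fix e assume "e \<in> B"
    then have "norm (great_circle q e s) = 1" for s
      using norm_great_circle[OF q] frame_subset[OF B] B unfolding horizontal_frame_def by blast
    then have "f (?g (great_circle q e s)) = f (great_circle q e s)" for s
      using f(2) unfolding circle_invariant_def by blast
    then show "(deriv ^^ 2) (\<lambda>s. f (?g (great_circle q e s))) 0 = (deriv ^^ 2) (\<lambda>s. f (great_circle q e s)) 0"
      by simp
  qed
  also have "\<dots> = sphere_subLaplacian f q"
    using sphere_poly_subLaplacian(2)[OF f(1) q B] by simp
  finally show "sphere_subLaplacian f (?g q) = sphere_subLaplacian f q" .
qed

lemma cproj_qact_cis: "cproj (qact (cis \<theta>, 0) q) = cproj q"
proof -
  have "cproj (qact (cis \<theta>, 0) q) \<subseteq> cproj q" for \<theta> and q :: "'n::finite hvec"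
    unfolding cproj_def by (auto simp: qact_cis_qact_cis)
  from this[of \<theta> q] this[of "- \<theta>" "qact (cis \<theta>, 0) q"] show ?thesis
    by (simp add: qact_cis_qact_cis subset_antisym)
qed

lemma rep_cproj: obtains \<theta> where "rep (cproj q) = qact (cis \<theta>, 0) q"
proof -
  have "q \<in> cproj q" unfolding cproj_def by (auto intro!: exI[of _ 0])
  then have "rep (cproj q) \<in> cproj q" unfolding rep_def by (rule someI)
  then show ?thesis using that unfolding cproj_def by blast
qed

text \<open>The representative is an unspecified point of the orbit of \<open>q\<close>, so an
  invariant function does not notice the choice. This lets invariant functions descend as
  \<open>\<lambda>X. f (rep X)\<close>.\<close>

lemma invariant_rep_cproj:
  "circle_invariant f \<Longrightarrow> norm q = 1 \<Longrightarrow> f (rep (cproj q)) = f q"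
  using rep_cproj[of q] unfolding circle_invariant_def by metis

lemma circle_invariant_cproj: "circle_invariant (f \<circ> cproj)"
  by (simp add: circle_invariant_def cproj_qact_cis)

lemma CP_subLaplacian_eq: "CP_subLaplacian f X = sphere_subLaplacian (f \<circ> cproj) (rep X)"
  by (simp add: CP_subLaplacian_def sphere_subLaplacian_def)

lemma CP_subLaplacian_cproj:
  "sphere_poly k c (f \<circ> cproj) \<Longrightarrow> norm q = 1 \<Longrightarrow>
    CP_subLaplacian f (cproj q) = sphere_subLaplacian (f \<circ> cproj) q"
  unfolding CP_subLaplacian_eq
  by (rule invariant_rep_cproj[OF sphere_subLaplacian_invariant[OF _ circle_invariant_cproj]])

lemma sphere_poly_cong:
  "sphere_poly k c f \<Longrightarrow> (\<And>q. norm q = 1 \<Longrightarrow> g q = f q) \<Longrightarrow> sphere_poly k c g"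
  unfolding sphere_poly_def by metis

section \<open>The two heat semigroups and their agreement on polynomials\<close>

lemma sphere_cont_bounded: "f \<in> sphere_cont \<Longrightarrow> \<exists>m. \<forall>x\<in>hsphere. \<bar>f x\<bar> \<le> m"
proof -
  assume "f \<in> sphere_cont"
  then have "compact (f ` hsphere)"
    unfolding sphere_cont_def by (intro compact_continuous_image) auto
  then show ?thesis using compact_imp_bounded by (force simp: bounded_iff)
qed

lemma sphere_heat_semigroup_on:
  assumes "heat_semigroup hsphere sphere_cont sphere_smooth sphere_subLaplacian P"
  shows "heat_semigroup_on hsphere sphere_cont sphere_smooth sphere_subLaplacian P"
proof
  show "\<exists>m. \<forall>x\<in>hsphere. \<bar>f x\<bar> \<le> m" if "f \<in> sphere_cont" for f :: "'a hvec \<Rightarrow> real"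
    using sphere_cont_bounded[OF that] by blast
  show "f \<in> sphere_cont" if "\<And>n. u n \<in> sphere_cont" "uniform_limit hsphere u f sequentially"
    for u :: "nat \<Rightarrow> 'a hvec \<Rightarrow> real" and f
    using uniform_limit_theorem[OF _ that(2)] that(1) by (simp add: sphere_cont_def)
qed (use assms in \<open>auto simp: sphere_cont_def intro!: continuous_intros\<close>)

lemma CP_heat_semigroup_on:
  assumes "heat_semigroup CPspace CP_cont CP_smooth CP_subLaplacian Q"
  shows "heat_semigroup_on CPspace CP_cont CP_smooth CP_subLaplacian Q"
proof
  show "\<exists>m. \<forall>x\<in>CPspace. \<bar>f x\<bar> \<le> m" if "f \<in> CP_cont" for f :: "'a hvec set \<Rightarrow> real"
    using sphere_cont_bounded[of "f \<circ> cproj"] that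
    by (metis (no_types, lifting) CPspace_def CP_cont_def comp_apply imageE mem_Collect_eq)
  show "f \<in> CP_cont" if "\<And>n. u n \<in> CP_cont" "uniform_limit CPspace u f sequentially"
    for u :: "nat \<Rightarrow> 'a hvec set \<Rightarrow> real" and f
  proof -
    have "uniform_limit hsphere (\<lambda>n. u n \<circ> cproj) (f \<circ> cproj) sequentially"
      using that(2) by (auto simp: uniform_limit_iff CPspace_def)
    from uniform_limit_theorem[OF _ this] that(1) show ?thesis
      by (simp add: CP_cont_def sphere_cont_def)
  qed
qed (use assms in \<open>auto simp: CP_cont_def sphere_cont_def o_def intro!: continuous_intros\<close>)

text \<open>The iterates \<open>F j\<close> on the quotient pull back to iterates on the sphere with
  the same bounds \<open>c * ?N ^ j\<close>. Both semigroups are then given by exponential series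
  with identical terms, and sums are unique.\<close>

lemma semigroups_agree_on_polynomials:
  fixes f :: "'n::finite hvec set \<Rightarrow> real"
  assumes P: "heat_semigroup hsphere sphere_cont sphere_smooth sphere_subLaplacian P"
    and Q: "heat_semigroup CPspace CP_cont CP_smooth CP_subLaplacian Q"
    and f: "sphere_poly k c (f \<circ> cproj)" and q: "norm q = 1" and t: "t \<ge> 0"
  shows "Q t f (cproj q) = P t (f \<circ> cproj) q"
proof -
  interpret S: heat_semigroup_on hsphere sphere_cont sphere_smooth sphere_subLaplacian P
    using P by (rule sphere_heat_semigroup_on)
  interpret CP: heat_semigroup_on CPspace CP_cont CP_smooth CP_subLaplacian Q
    using Q by (rule CP_heat_semigroup_on)
  let ?N = "growth_const TYPE('n) k"
  define F where "F j = (CP_subLaplacian ^^ j) f" for j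
  have F0: "F 0 = f" and F_Suc: "F (Suc j) = CP_subLaplacian (F j)" for j
    by (simp_all add: F_def)
  have poly: "sphere_poly k (c * ?N ^ j) (F j \<circ> cproj)" for j
  proof (induction j)
    case (Suc j)
    from sphere_poly_subLaplacian(1)[OF Suc]
    have "sphere_poly k (c * ?N ^ Suc j) (sphere_subLaplacian (F j \<circ> cproj))"
      by (simp add: mult_ac o_def)
    then show ?case
      by (rule sphere_poly_cong) (simp add: F_Suc CP_subLaplacian_cproj[OF Suc])
  qed (use f in \<open>simp add: F0 o_def\<close>)
  have sm: "F j \<circ> cproj \<in> sphere_smooth" for j by (rule sphere_poly_smooth[OF poly])
  then have cont: "F j \<circ> cproj \<in> sphere_cont" for j by (rule smooth_imp_cont)
  have 1: "(\<lambda>j. (F j \<circ> cproj) q * t ^ j / fact j) sums P t (F 0 \<circ> cproj) q"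
  proof (rule S.P_exp_series)
    show "sphere_subLaplacian (F j \<circ> cproj) x = (F (Suc j) \<circ> cproj) x" if "x \<in> hsphere" for j x
      using that CP_subLaplacian_cproj[OF poly[of j], of x] by (simp add: F_Suc)
    show "\<bar>(F j \<circ> cproj) x\<bar> \<le> c * ?N ^ j" if "x \<in> hsphere" for j x
      using sphere_poly_bound[OF poly[of j], of x] that by simp
  qed (use sm cont q t in \<open>simp_all add: o_def\<close>)
  have 2: "(\<lambda>j. F j (cproj q) * t ^ j / fact j) sums Q t (F 0) (cproj q)"
  proof (rule CP.P_exp_series)
    show "\<bar>F j X\<bar> \<le> c * ?N ^ j" if "X \<in> CPspace" for j X
      using sphere_poly_bound[OF poly[of j]] that by (auto simp: CPspace_def)
  qed (use sm cont q t in \<open>auto simp: CP_cont_def CP_smooth_def F_Suc CPspace_def o_def\<close>)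
  show ?thesis using sums_unique2[OF 2] 1 by (simp add: F0)
qed


section \<open>Averaging over the circle\<close>

lemma qact_cis: "qact (cis \<theta>, 0) q = cos \<theta> *\<^sub>R q + sin \<theta> *\<^sub>R qact hI q"
proof -
  have "(cis \<theta>, 0) = cos \<theta> *\<^sub>R ((1, 0) :: quat) + sin \<theta> *\<^sub>R hI"
    by (simp add: hI_def prod_eq_iff complex_eq_iff)
  then show ?thesis by (simp only: qact_add_left qact_scaleR_left qact_one)
qed

lemma bounded_linear_qact: "bounded_linear (qact g)"
  using linear_qact by (simp add: linear_conv_bounded_linear)

lemma continuous_on_qact_cis [continuous_intros]:
  fixes S :: "'a::t2_space set"
  assumes "continuous_on S f" "continuous_on S g"
  shows "continuous_on S (\<lambda>x. qact (cis (f x), 0) (g x))"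
  unfolding qact_cis
  by (intro continuous_intros assms bounded_linear.continuous_on[OF bounded_linear_qact])

definition circle_avg :: "('n::finite hvec \<Rightarrow> real) \<Rightarrow> 'n hvec \<Rightarrow> real" where
  "circle_avg g q = 1 / (2 * pi) * integral {0..2 * pi} (\<lambda>\<theta>. g (qact (cis \<theta>, 0) q))"

lemma continuous_on_orbit:
  fixes S :: "real set"
  assumes "continuous_on hsphere g" "norm q = 1"
  shows "continuous_on S (\<lambda>\<theta>. g (qact (cis \<theta>, 0) q))"
  by (rule continuous_on_compose2[OF assms(1)]) (auto intro!: continuous_intros simp: norm_qact_cis assms(2))

lemma integrable_orbit:
  fixes g :: "'n::finite hvec \<Rightarrow> real"
  shows "continuous_on hsphere g \<Longrightarrow> norm q = 1 \<Longrightarrow> (\<lambda>\<theta>. g (qact (cis \<theta>, 0) q)) integrable_on {a..b}"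
  by (rule integrable_continuous_interval, rule continuous_on_orbit)

lemma continuous_on_circle_avg:
  assumes "continuous_on hsphere g"
  shows "continuous_on hsphere (circle_avg g)"
proof -
  have "continuous_on (hsphere \<times> cbox 0 (2 * pi)) (\<lambda>(q, \<theta>). g (qact (cis \<theta>, 0) q))"
    unfolding split_beta
    by (rule continuous_on_compose2[OF assms]) (auto intro!: continuous_intros simp: norm_qact_cis)
  from integral_continuous_on_param[OF this] show ?thesis
    unfolding circle_avg_def[abs_def] by (intro continuous_intros) simp
qed

lemma integral_periodic:
  fixes f :: "real \<Rightarrow> real"
  assumes f: "continuous_on UNIV f" and per: "\<And>x. f (x + p) = f x" and p: "p \<ge> 0"
  shows "integral {0..p} (\<lambda>x. f (x + a)) = integral {0..p} f"
proof -
  have int: "f integrable_on {x..y}" for x y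
    by (rule integrable_continuous_interval) (rule continuous_on_subset[OF f], simp)
  have shift: "integral {0..p} (\<lambda>x. f (x + a)) = integral {a..a + p} f" for a
  proof -
    have "((\<lambda>x. f (x + a)) has_integral integral {a..a + p} f) ((\<lambda>x. x - a) ` {a..a + p})"
      using has_integral_affinity[of f "integral {a..a + p} f" a "a + p" 1 a] int[of a "a + p"] p
      by (simp add: has_integral_integral)
    moreover have "(\<lambda>x. x - a) ` {a..a + p} = {0..p}" by (auto simp: image_iff algebra_simps) 
    ultimately show ?thesis by (simp add: integral_unique)
  qed
  have pos: "integral {a..a + p} f = integral {0..p} f" if a: "0 \<le> a" "a \<le> p" for a
  proof -
    have "integral {a..a + p} f = integral {a..p} f + integral {p..a + p} f"
      using a p by (intro Henstock_Kurzweil_Integration.integral_combine[symmetric] int) auto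
    also have "integral {p..a + p} f = integral {0..a} f"
    proof -
      have "((\<lambda>x. f (x + p)) has_integral integral {p..a + p} f) ((\<lambda>x. x - p) ` {p..a + p})"
        using has_integral_affinity[of f "integral {p..a + p} f" p "a + p" 1 p] int[of p "a + p"] a
        by (simp add: has_integral_integral)
      moreover have "(\<lambda>x. x - p) ` {p..a + p} = {0..a}" by (auto simp: image_iff algebra_simps)
      ultimately show ?thesis by (simp add: per integral_unique)
    qed
    also have "integral {a..p} f + integral {0..a} f = integral {0..p} f"
      using Henstock_Kurzweil_Integration.integral_combine[OF a int] by simp
    finally show ?thesis .
  qed
  show ?thesis
  proof (cases "p = 0")
    case False
    \<comment> \<open>The shift is reduced modulo the period to the interval from 0 to
      \<open>p\<close>, where cutting the integral at \<open>p\<close> suffices.\<close>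
    define b where "b = a - p * of_int \<lfloor>a / p\<rfloor>"
    have perk: "f (x + p * of_int k) = f x" for x and k :: int
    proof (induction k arbitrary: x rule: int_induct[of _ 0])
      case (step1 i) then show ?case using per[of "x + p * of_int i"] by (simp add: algebra_simps)
    next
      case (step2 i) then show ?case using per[of "x + p * of_int (i - 1)"] by (simp add: algebra_simps)
    qed simp
    have "f (x + a) = f (x + b)" for x
      using perk[of "x + b" "\<lfloor>a / p\<rfloor>"] by (simp add: b_def algebra_simps)
    moreover have "0 \<le> b" "b \<le> p"
      using floor_divide_lower[of p a] floor_divide_upper[of p a] False p
      by (auto simp: b_def algebra_simps)
    ultimately show ?thesis using shift[of b] pos[of b] by simp
  qed simp
qed

lemma circle_avg_invariant:
  assumes "continuous_on hsphere g"
  shows "circle_invariant (circle_avg g)"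
  unfolding circle_invariant_def circle_avg_def
proof (intro allI impI)
  fix \<alpha> and q :: "'a hvec" assume "norm q = 1"
  then have "integral {0..2 * pi} (\<lambda>\<theta>. g (qact (cis (\<theta> + \<alpha>), 0) q))
      = integral {0..2 * pi} (\<lambda>\<theta>. g (qact (cis \<theta>, 0) q))"
    by (intro integral_periodic continuous_on_orbit assms) (simp_all add: cis_mult[symmetric])
  then show "1 / (2 * pi) * integral {0..2 * pi} (\<lambda>\<theta>. g (qact (cis \<theta>, 0) (qact (cis \<alpha>, 0) q)))
      = 1 / (2 * pi) * integral {0..2 * pi} (\<lambda>\<theta>. g (qact (cis \<theta>, 0) q))"
    by (simp add: qact_cis_qact_cis)
qed

text \<open>An invariant function is its own average, and averaging does not increase the uniform
  distance.\<close>

lemma circle_avg_near: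
  assumes g: "continuous_on hsphere g" and F: "circle_invariant F"
    and near: "\<And>x. norm x = 1 \<Longrightarrow> \<bar>F x - g x\<bar> \<le> e" and q: "norm q = 1"
  shows "\<bar>F q - circle_avg g q\<bar> \<le> e"
proof -
  have "((\<lambda>\<theta>. F q - g (qact (cis \<theta>, 0) q)) has_integral
      (2 * pi * F q - integral {0..2 * pi} (\<lambda>\<theta>. g (qact (cis \<theta>, 0) q)))) {0..2 * pi}"
    using has_integral_const_real[of "F q" 0 "2 * pi"] integrable_orbit[OF g q]
    by (intro has_integral_diff) (simp_all add: has_integral_integral)
  then have "norm (2 * pi * F q - integral {0..2 * pi} (\<lambda>\<theta>. g (qact (cis \<theta>, 0) q))) \<le> e * measure lborel {0..2 * pi}"
  proof (rule has_integral_bound_real[rotated 2])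
    show "0 \<le> e" using near[OF q] by linarith
    show "norm (F q - g (qact (cis x, 0) q)) \<le> e" if "x \<in> {0..2 * pi} - {}" for x
    proof -
      have "F (qact (cis x, 0) q) = F q" using F q unfolding circle_invariant_def by blast
      then show ?thesis using near[of "qact (cis x, 0) q"] q by (simp add: norm_qact_cis)
    qed
  qed simp
  moreover have "2 * pi * F q - integral {0..2 * pi} (\<lambda>\<theta>. g (qact (cis \<theta>, 0) q))
      = 2 * pi * (F q - circle_avg g q)"
    by (simp add: circle_avg_def field_simps)
  ultimately show ?thesis by (simp add: abs_mult)
qed

text \<open>Finite sums of products separate the circle variable from the quaternionic one, so that averaging
  keeps polynomials.\<close>

inductive separated :: "(real \<Rightarrow> 'n::finite hvec \<Rightarrow> real) \<Rightarrow> bool" where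
  prod: "continuous_on UNIV c \<Longrightarrow> real_polynomial_function m \<Longrightarrow> separated (\<lambda>\<theta> q. c \<theta> * m q)"
| add: "separated F \<Longrightarrow> separated G \<Longrightarrow> separated (\<lambda>\<theta> q. F \<theta> q + G \<theta> q)"

lemma separated_mult_prod:
  assumes "continuous_on UNIV c" "real_polynomial_function m"
  shows "separated G \<Longrightarrow> separated (\<lambda>\<theta> q. (c \<theta> * m q) * G \<theta> q)"
proof (induction rule: separated.induct)
  case (prod c' m')
  then have "separated (\<lambda>\<theta> q. (c \<theta> * c' \<theta>) * (m q * m' q))"
    using assms by (intro separated.prod continuous_intros real_polynomial_function.intros(4))
  then show ?case by (simp add: mult_ac)
next
  case (add F G)
  from separated.add[OF add.IH] show ?case by (simp add: distrib_left)
qed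

lemma separated_mult: "separated F \<Longrightarrow> separated G \<Longrightarrow> separated (\<lambda>\<theta> q. F \<theta> q * G \<theta> q)"
proof (induction rule: separated.induct)
  case (add F F')
  from separated.add[OF add.IH(1,2)[OF add.prems]] show ?case by (simp add: distrib_right)
qed (rule separated_mult_prod)

text \<open>The orbit point is
  \<open>cos \<theta> *\<^sub>R q + sin \<theta> *\<^sub>R qact hI q\<close>, so a linear form
  splits into two products; sums and products of polynomials preserve the property.\<close>

lemma polynomial_separated:
  "real_polynomial_function g \<Longrightarrow> separated (\<lambda>\<theta> q. g (qact (cis \<theta>, 0) q))"
proof (induction rule: real_polynomial_function.induct)
  case (linear f)
  note f = linear
  then interpret bounded_linear f .
  have "separated (\<lambda>\<theta> q. cos \<theta> * f q + sin \<theta> * f (qact hI q))"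
    by (intro separated.intros continuous_intros real_polynomial_function.intros(1)
        bounded_linear_compose[OF f bounded_linear_qact] f)
  then show ?case by (simp add: qact_cis add scaleR)
next
  case (const a)
  then show ?case using separated.prod[of "\<lambda>_. 1" "\<lambda>_. a"] by (simp add: real_polynomial_function.intros)
qed (simp_all add: separated.add separated_mult)

text \<open>Continuity in the circle variable accompanies the induction because the integral of a
  sum is split there into integrals of integrable summands.\<close>

lemma separated_integral:
  "separated F \<Longrightarrow> (\<forall>q. continuous_on UNIV (\<lambda>\<theta>. F \<theta> q)) \<and>
    real_polynomial_function (\<lambda>q. integral {a..b} (\<lambda>\<theta>. F \<theta> q))"
proof (induction rule: separated.induct)
  case (prod c m)
  then show ?case by (auto intro!: continuous_intros real_polynomial_function.intros(2,4))
next
  case (add F G)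
  have "(\<lambda>\<theta>. H \<theta> q) integrable_on {a..b}" if "\<forall>q. continuous_on UNIV (\<lambda>\<theta>. H \<theta> q)" for H :: "real \<Rightarrow> 'a hvec \<Rightarrow> real" and q
    by (rule integrable_continuous_interval) (rule continuous_on_subset[OF that[rule_format]], simp)
  with add.IH show ?case
    by (auto simp: Henstock_Kurzweil_Integration.integral_add intro!: continuous_intros real_polynomial_function.intros(3))
qed

lemma polynomial_circle_avg:
  "real_polynomial_function g \<Longrightarrow> real_polynomial_function (circle_avg g)"
  unfolding circle_avg_def[abs_def]
  by (intro real_polynomial_function.intros(2,4)) (use separated_integral[OF polynomial_separated] in blast)

lemma CP_polynomials_dense:
  assumes f: "f \<in> CP_cont" and e: "e > 0"
  obtains u k c where "sphere_poly k c (u \<circ> cproj)" "\<And>X. X \<in> CPspace \<Longrightarrow> \<bar>f X - u X\<bar> \<le> e"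
proof -
  have fc: "continuous_on hsphere (f \<circ> cproj)" using f by (simp add: CP_cont_def sphere_cont_def)
  obtain g where g: "real_polynomial_function g" "\<And>x. x \<in> hsphere \<Longrightarrow> \<bar>(f \<circ> cproj) x - g x\<bar> < e"
    using Stone_Weierstrass_real_polynomial_function[OF compact_sphere fc e] by blast
  have gc: "continuous_on hsphere g"
    using g(1) by (simp add: continuous_on_polymonial_function real_polynomial_function_eq)
  define u where "u X = circle_avg g (rep X)" for X
  have u: "u (cproj q) = circle_avg g q" if "norm q = 1" for q
    unfolding u_def using circle_avg_invariant[OF gc] that by (rule invariant_rep_cproj)
  obtain k c where "bpoly k c (circle_avg g)"
    using polynomial_imp_bpoly[OF polynomial_circle_avg[OF g(1)]] by blast
  then have "sphere_poly k c (u \<circ> cproj)"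
    unfolding sphere_poly_def using u by auto
  moreover have "\<bar>f X - u X\<bar> \<le> e" if X: "X \<in> CPspace" for X
  proof -
    obtain q where q: "norm q = 1" "X = cproj q" using X by (auto simp: CPspace_def)
    have "\<bar>(f \<circ> cproj) q - circle_avg g q\<bar> \<le> e"
      by (rule circle_avg_near[OF gc circle_invariant_cproj _ q(1)]) (use g(2) in \<open>auto simp: less_imp_le\<close>)
    then show ?thesis using u q by simp
  qed
  ultimately show ?thesis using that by blast
qed

lemma semigroups_agree:
  fixes f :: "'n::finite hvec set \<Rightarrow> real"
  assumes P: "heat_semigroup hsphere sphere_cont sphere_smooth sphere_subLaplacian P"
    and Q: "heat_semigroup CPspace CP_cont CP_smooth CP_subLaplacian Q"
    and f: "f \<in> CP_cont" and q: "norm q = 1" and t: "t \<ge> 0"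
  shows "Q t f (cproj q) = P t (f \<circ> cproj) q"
proof -
  interpret S: heat_semigroup_on hsphere sphere_cont sphere_smooth sphere_subLaplacian P
    using P by (rule sphere_heat_semigroup_on)
  interpret CP: heat_semigroup_on CPspace CP_cont CP_smooth CP_subLaplacian Q
    using Q by (rule CP_heat_semigroup_on)
  let ?K = "S.opnorm t + CP.opnorm t"
  have qS: "q \<in> hsphere" "cproj q \<in> CPspace" using q by (auto simp: CPspace_def)
  have fS: "f \<circ> cproj \<in> sphere_cont" using f by (simp add: CP_cont_def)
  have est: "\<bar>Q t f (cproj q) - P t (f \<circ> cproj) q\<bar> \<le> ?K * e" if e: "e > 0" for e
  proof -
    obtain u k c where u: "sphere_poly k c (u \<circ> cproj)" "\<And>X. X \<in> CPspace \<Longrightarrow> \<bar>f X - u X\<bar> \<le> e"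
      using CP_polynomials_dense[OF f e] by metis
    have uS: "u \<circ> cproj \<in> sphere_cont" using sphere_poly_smooth[OF u(1)] smooth_imp_cont by blast
    then have uC: "u \<in> CP_cont" by (simp add: CP_cont_def)
    have "\<bar>Q t (\<lambda>X. f X - u X) (cproj q)\<bar> \<le> CP.opnorm t * e"
      using u f uC qS t by (intro CP.opnorm_upper CP.C_diff)
    moreover have "\<bar>P t (\<lambda>x. (f \<circ> cproj) x - (u \<circ> cproj) x) q\<bar> \<le> S.opnorm t * e"
      using u(2) fS uS qS t by (intro S.opnorm_upper S.C_diff) (auto simp: CPspace_def o_def)
    moreover have "Q t u (cproj q) = P t (u \<circ> cproj) q"
      by (rule semigroups_agree_on_polynomials[OF P Q u(1) q t])
    ultimately show ?thesis
      using CP.P_diff[OF t f uC qS(2)] S.P_diff[OF t fS uS qS(1)] by (simp add: distrib_right o_def) 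
  qed
  show ?thesis
  proof (rule ccontr)
    assume "\<not> ?thesis"
    then have d: "\<bar>Q t f (cproj q) - P t (f \<circ> cproj) q\<bar> > 0" (is "?d > 0") by simp
    \<comment> \<open>A positive upper bound of \<open>?K\<close>: with
      \<open>e = ?d / (2 * L)\<close> the estimate would give
      \<open>?d \<le> ?d / 2\<close>.\<close>
    define L where "L = \<bar>?K\<bar> + 1"
    have L: "L > 0" unfolding L_def by (rule add_nonneg_pos) auto
    define e where "e = ?d / (2 * L)"
    have e: "e > 0" using d L unfolding e_def by simp
    have "?K \<le> L" unfolding L_def by (rule order_trans[OF abs_ge_self]) simp
    then have "?K * e \<le> L * e" using e by (intro mult_right_mono) auto
    also have "\<dots> = ?d / 2" using L by (simp add: e_def)
    also have "\<dots> < ?d" using d by simp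
    finally show False using est[OF e] by linarith
  qed
qed


section \<open>The Riemannian measure of the sphere\<close>

text \<open>By Vitali, an open set is, up to a null set, a disjoint union of balls, and an isometry maps
  balls to balls of the same measure.\<close>

lemma emeasure_orthogonal_image_ge:
  fixes T :: "'a::euclidean_space \<Rightarrow> 'a"
  assumes T: "orthogonal_transformation T" and U: "open U"
  shows "emeasure lborel U \<le> emeasure lborel (T ` U)"
proof -
  let ?K = "{(x, d). d > 0 \<and> cball x d \<subseteq> U}"
  have cover: "\<exists>i. i \<in> ?K \<and> x \<in> cball (fst i) (snd i) \<and> snd i < d" if x: "x \<in> U" "0 < d" for x d
  proof -
    obtain e where e: "e > 0" "cball x e \<subseteq> U" using x(1) open_contains_cball_eq[OF U] by metis
    have "cball x (min e (d / 2)) \<subseteq> U" using e(2) by (auto simp: subset_iff)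
    then show ?thesis using e x by (intro exI[of _ "(x, min e (d / 2))"]) auto
  qed
  obtain C where C: "countable C" "C \<subseteq> ?K"
    "pairwise (\<lambda>i j. disjnt (cball (fst i) (snd i)) (cball (fst j) (snd j))) C"
    "negligible (U - (\<Union>i\<in>C. cball (fst i) (snd i)))"
  proof (rule Vitali_covering_theorem_cballs[of ?K snd U fst])
    show "0 < snd i" if "i \<in> ?K" for i using that by auto
  qed (use cover in \<open>blast+\<close>)
  let ?b = "\<lambda>i. cball (fst i) (snd i) :: 'a set"
  have bor: "(\<Union>i\<in>C. ?b i) \<in> sets borel"
    by (rule sets.countable_UN'[OF C(1)]) auto
  have inK: "snd i > 0" "?b i \<subseteq> U" if "i \<in> C" for i
    using subsetD[OF C(2) that] by (simp_all add: split_beta)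
  then have sub: "(\<Union>i\<in>C. ?b i) \<subseteq> U" by blast
  \<comment> \<open>\<open>negligible\<close> refers to the completed Lebesgue measure; the
    remainder is a Borel set, so it is null for \<open>lborel\<close> as well.\<close>
  have "U - (\<Union>i\<in>C. ?b i) \<in> null_sets lborel"
    using C(4) U bor by (subst null_sets_completion_iff[symmetric]) (auto simp: negligible_iff_null_sets)
  then have "emeasure lborel U = emeasure lborel (\<Union>i\<in>C. ?b i)"
    using emeasure_Un_null_set[of "\<Union>i\<in>C. ?b i" lborel "U - (\<Union>i\<in>C. ?b i)"] sub bor
    by (simp add: Un_absorb1)
  also have "\<dots> = (\<integral>\<^sup>+ i. emeasure lborel (?b i) \<partial>count_space C)"
    using C(1,3) by (intro emeasure_UN_countable) (auto simp: disjoint_family_on_def pairwise_def disjnt_def)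
  also have "\<dots> = (\<integral>\<^sup>+ i. emeasure lborel (T ` ?b i) \<partial>count_space C)"
    by (rule nn_integral_cong)
      (simp add: image_orthogonal_transformation_cball[OF T] emeasure_cball less_imp_le[OF inK(1)])
  also have "\<dots> = emeasure lborel (\<Union>i\<in>C. T ` ?b i)"
  proof (rule emeasure_UN_countable[symmetric])
    show "disjoint_family_on (\<lambda>i. T ` ?b i) C"
      using C(3) orthogonal_transformation_inj[OF T]
      by (fastforce simp: disjoint_family_on_def pairwise_def disjnt_def inj_def)
  qed (use C(1) in \<open>auto simp: image_orthogonal_transformation_cball[OF T]\<close>)
  also have "\<dots> \<le> emeasure lborel (T ` U)"
  proof (rule emeasure_mono)
    have "T ` U \<in> sets borel"
      using open_surjective_linear_image[OF U orthogonal_transformation_linear[OF T] orthogonal_transformation_surj[OF T]]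
      by simp
    then show "T ` U \<in> sets lborel" by simp
  qed (use sub in blast)
  finally show ?thesis .
qed

text \<open>The inequality for open sets, applied to \<open>T\<close> and to its inverse, becomes an
  equality on boxes, and boxes determine Lebesgue measure.\<close>

lemma lborel_distr_orthogonal:
  fixes T :: "'a::euclidean_space \<Rightarrow> 'a"
  assumes T: "orthogonal_transformation T"
  shows "distr lborel borel T = lborel"
proof (rule lborel_eqI[symmetric])
  fix l u :: 'a assume le: "\<And>b. b \<in> Basis \<Longrightarrow> l \<bullet> b \<le> u \<bullet> b"
  note bij = orthogonal_transformation_bij[OF T]
  have cont: "continuous_on UNIV T"
    by (simp add: linear_continuous_on linear_conv_bounded_linear[symmetric] orthogonal_transformation_linear[OF T])
  have opn: "open (T -` box l u)" by (rule open_vimage[OF open_box cont])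
  have im: "T ` (T -` box l u) = box l u" using bij by (simp add: bij_is_surj surj_image_vimage_eq)
  have im': "inv T ` box l u = T -` box l u" using bij by (simp add: bij_vimage_eq_inv_image)
  have "emeasure lborel (T -` box l u) = emeasure lborel (box l u)"
    using emeasure_orthogonal_image_ge[OF T opn]
      emeasure_orthogonal_image_ge[OF orthogonal_transformation_inv[OF T] open_box[of l u]]
    unfolding im im' by (rule antisym)
  moreover have "T \<in> measurable lborel borel"
    using borel_measurable_continuous_onI[OF cont] by simp
  then have "emeasure (distr lborel borel T) (box l u) = emeasure lborel (T -` box l u)"
    by (subst emeasure_distr) simp_all
  ultimately show "emeasure (distr lborel borel T) (box l u) = (\<Prod>b\<in>Basis. (u - l) \<bullet> b)"
    by (simp only: emeasure_lborel_box[OF le])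
qed simp

section \<open>The cone measure on the sphere, its total mass and its invariance\<close>

lemma space_sphere_measure [simp]: "space sphere_measure = hsphere"
  by (simp add: sphere_measure_def space_scale_measure space_restrict_space)

lemma sets_sphere_measure [simp, measurable_cong]: "sets sphere_measure = sets (restrict_space borel hsphere)"
  by (simp add: sphere_measure_def)

lemma measurable_sphere_measure: "measurable sphere_measure N = measurable (restrict_space borel hsphere) N"
  by (rule measurable_cong_sets) simp_all

lemma sgn_measurable:
  "sgn \<in> restrict_space lborel (cball 0 1 - {0}) \<rightarrow>\<^sub>M restrict_space borel (hsphere :: 'n::finite hvec set)"
proof (rule measurable_restrict_space2)
  have "sgn \<in> borel_measurable (restrict_space borel (cball 0 1 - {0} :: 'n hvec set))"
    by (rule borel_measurable_continuous_on_restrict) (auto simp: sgn_div_norm intro!: continuous_intros)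
  then show "sgn \<in> borel_measurable (restrict_space lborel (cball 0 1 - {0} :: 'n hvec set))"
    by (subst measurable_cong_sets[where M' = "restrict_space borel (cball 0 1 - {0})"])
       (simp_all add: sets_restrict_space)
qed (auto simp: space_restrict_space norm_sgn)

lemma emeasure_sphere_measure:
  fixes A :: "'n::finite hvec set"
  assumes "A \<in> sets (restrict_space borel hsphere)"
  shows "emeasure sphere_measure A = ennreal (real DIM('n hvec)) * emeasure lborel (sgn -` A \<inter> (cball 0 1 - {0}))"
proof -
  have c: "cball 0 1 - {0} \<in> sets (borel :: 'n hvec measure)" by auto
  then show ?thesis
    unfolding sphere_measure_def emeasure_scale_measure
    by (subst emeasure_distr[OF sgn_measurable assms], subst emeasure_restrict_space)
       (auto simp: space_restrict_space)
qed

lemma total_sphere_measure: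
  "emeasure sphere_measure (hsphere :: 'n::finite hvec set) = ennreal (real DIM('n hvec) * unit_ball_vol (real DIM('n hvec)))"
proof -
  have "sgn -` (hsphere :: 'n hvec set) \<inter> (cball 0 1 - {0}) = cball 0 1 - {0}"
    by (auto simp: norm_sgn)
  moreover have "emeasure lborel (cball 0 1 - {0 :: 'n hvec}) = emeasure lborel (cball (0 :: 'n hvec) 1)"
    by (rule emeasure_Diff_null_set) auto
  moreover have "(hsphere :: 'n hvec set) \<in> sets (restrict_space borel hsphere)"
    using sets.top[of "restrict_space borel (hsphere :: 'n hvec set)"] by (simp add: space_restrict_space)
  ultimately show ?thesis
    by (subst emeasure_sphere_measure) (simp_all add: emeasure_cball ennreal_mult' del: DIM_prod)
qed

lemma finite_sphere_measure: "finite_measure sphere_measure"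
  by (rule finite_measureI) (simp add: total_sphere_measure)

lemma sphere_cont_measurable:
  "f \<in> sphere_cont \<Longrightarrow> f \<in> borel_measurable (restrict_space borel hsphere)"
  unfolding sphere_cont_def by (auto intro: borel_measurable_continuous_on_restrict)

lemma sphere_cont_integrable:
  assumes "f \<in> sphere_cont"
  shows "integrable sphere_measure f"
proof -
  interpret finite_measure sphere_measure by (rule finite_sphere_measure)
  obtain m where "\<forall>x\<in>hsphere. \<bar>f x\<bar> \<le> m" using sphere_cont_bounded[OF assms] by blast
  then show ?thesis
    using sphere_cont_measurable[OF assms]
    by (intro integrable_const_bound[of _ m] AE_I2) (auto simp: measurable_sphere_measure)
qed

lemma orthogonal_qact_cis: "orthogonal_transformation (qact (cis \<theta>, 0))"
  by (simp add: orthogonal_transformation linear_qact norm_qact_cis del: norm_prod_def)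

lemma qact_cis_measurable:
  "qact (cis \<theta>, 0) \<in> restrict_space borel hsphere \<rightarrow>\<^sub>M restrict_space borel (hsphere :: 'n::finite hvec set)"
proof (rule measurable_restrict_space2)
  show "qact (cis \<theta>, 0) \<in> borel_measurable (restrict_space borel (hsphere :: 'n hvec set))"
    by (intro borel_measurable_continuous_on_restrict continuous_intros)
qed (auto simp: space_restrict_space norm_qact_cis)

text \<open>The action is linear and preserves norms, so the cone over a preimage is the preimage of
  the cone, and the invariance of Lebesgue measure passes to the sphere.\<close>

lemma sphere_measure_invariant:
  "distr sphere_measure (restrict_space borel hsphere) (qact (cis \<theta>, 0)) = (sphere_measure :: 'n::finite hvec measure)"
proof (rule measure_eqI)
  let ?T = "qact (cis \<theta>, 0) :: 'n hvec \<Rightarrow> 'n hvec"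
  fix A assume "A \<in> sets (distr sphere_measure (restrict_space borel hsphere) ?T)"
  then have A: "A \<in> sets (restrict_space borel (hsphere :: 'n hvec set))" by simp
  let ?B = "sgn -` A \<inter> (cball 0 1 - {0})"
  have TA: "?T -` A \<inter> hsphere \<in> sets (restrict_space borel (hsphere :: 'n hvec set))"
    using measurable_sets[OF qact_cis_measurable A] by (simp add: space_restrict_space)
  have vim: "sgn -` (?T -` A \<inter> hsphere) \<inter> (cball 0 1 - {0}) = ?T -` ?B"
  proof (rule set_eqI)
    fix x
    have "?T x = 0 \<longleftrightarrow> x = 0" using norm_qact_cis[of \<theta> x] by (metis norm_eq_zero)
    moreover have "sgn (?T x) = ?T (sgn x)"
      by (simp add: sgn_div_norm norm_qact_cis qact_scaleR_right)
    ultimately show "x \<in> sgn -` (?T -` A \<inter> hsphere) \<inter> (cball 0 1 - {0}) \<longleftrightarrow> x \<in> ?T -` ?B"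
      using norm_qact_cis[of \<theta> x] by (cases "x = 0") (simp_all add: norm_sgn)
  qed
  have "?B = sgn -` A \<inter> space (restrict_space lborel (cball 0 1 - {0}))"
    by (simp add: space_restrict_space)
  also have "\<dots> \<in> sets (restrict_space lborel (cball 0 1 - {0}))"
    by (rule measurable_sets[OF sgn_measurable A])
  finally have B: "?B \<in> sets borel"
    by (subst (asm) sets_restrict_space_iff) auto
  have "?T \<in> borel_measurable borel"
    by (intro borel_measurable_continuous_onI continuous_intros)
  then have "emeasure lborel (?T -` ?B) = emeasure (distr lborel borel ?T) ?B"
    using B by (subst emeasure_distr) auto
  also have "\<dots> = emeasure lborel ?B" by (simp add: lborel_distr_orthogonal[OF orthogonal_qact_cis])
  finally have "emeasure sphere_measure (?T -` A \<inter> hsphere) = emeasure sphere_measure A"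
    by (simp only: emeasure_sphere_measure[OF TA] emeasure_sphere_measure[OF A] vim)
  then show "emeasure (distr sphere_measure (restrict_space borel hsphere) ?T) A = emeasure sphere_measure A"
    using A qact_cis_measurable by (subst emeasure_distr) (simp_all add: measurable_sphere_measure)
qed simp

lemma integral_sphere_qact_cis:
  assumes "f \<in> sphere_cont"
  shows "(\<integral>q. f (qact (cis \<theta>, 0) q) \<partial>sphere_measure) = (\<integral>q. f q \<partial>sphere_measure)"
proof -
  have "(\<integral>q. f q \<partial>distr sphere_measure (restrict_space borel hsphere) (qact (cis \<theta>, 0))) =
      (\<integral>q. f (qact (cis \<theta>, 0) q) \<partial>sphere_measure)"
    by (rule integral_distr) (simp_all add: measurable_sphere_measure qact_cis_measurable sphere_cont_measurable[OF assms])
  then show ?thesis by (simp add: sphere_measure_invariant)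
qed

text \<open>For each fixed angle, rotating only the argument of \<open>K\<close> leaves the integral
  unchanged, because \<open>F\<close> and the measure are invariant. Integrating over the angle and
  exchanging the integrals produces the average; the exchange is justified by boundedness on a
  finite measure space.\<close>

lemma integral_circle_avg:
  fixes K F :: "'n::finite hvec \<Rightarrow> real"
  assumes K: "K \<in> sphere_cont" and F: "F \<in> sphere_cont" "circle_invariant F"
  shows "(\<integral>q. K q * F q \<partial>sphere_measure) = (\<integral>q. circle_avg K q * F q \<partial>sphere_measure)"
proof -
  let ?I = "restrict_space lborel {0..2 * pi}"
  let ?f = "\<lambda>\<theta> q. K (qact (cis \<theta>, 0) q) * F q"
  interpret S: finite_measure "sphere_measure :: 'n hvec measure" by (rule finite_sphere_measure)
  interpret I: finite_measure ?I
    by (rule finite_measureI) (simp add: space_restrict_space emeasure_restrict_space)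
  interpret pair_sigma_finite ?I "sphere_measure :: 'n hvec measure" ..
  interpret IS: finite_measure "?I \<Otimes>\<^sub>M (sphere_measure :: 'n hvec measure)"
    by (rule finite_measure_pair_measure) unfold_locales
  have fst_m: "fst \<in> borel_measurable (?I \<Otimes>\<^sub>M (sphere_measure :: 'n hvec measure))"
    by (rule measurable_compose[OF measurable_fst]) (auto intro: measurable_restrict_space1)
  have snd_r: "snd \<in> ?I \<Otimes>\<^sub>M sphere_measure \<rightarrow>\<^sub>M restrict_space borel (hsphere :: 'n hvec set)"
    using measurable_snd[of ?I "sphere_measure :: 'n hvec measure"]
    by (subst measurable_cong_sets[OF refl sets_sphere_measure[symmetric]])
  then have snd_m: "snd \<in> borel_measurable (?I \<Otimes>\<^sub>M (sphere_measure :: 'n hvec measure))"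
    by (rule measurable_compose) (auto intro: measurable_restrict_space1)
  have hI_m: "qact hI \<in> borel_measurable (borel :: 'n hvec measure)"
    by (intro borel_measurable_continuous_onI bounded_linear.continuous_on[OF bounded_linear_qact] continuous_on_id)
  have "(\<lambda>x. qact (cis (fst x), 0) (snd x)) \<in> ?I \<Otimes>\<^sub>M sphere_measure \<rightarrow>\<^sub>M restrict_space borel (hsphere :: 'n hvec set)"
  proof (rule measurable_restrict_space2)
    show "(\<lambda>x. qact (cis (fst x), 0) (snd x)) \<in> borel_measurable (?I \<Otimes>\<^sub>M (sphere_measure :: 'n hvec measure))"
      unfolding qact_cis using fst_m snd_m measurable_compose[OF snd_m hI_m] by measurable
  qed (auto simp: space_pair_measure norm_qact_cis)
  from measurable_compose[OF this sphere_cont_measurable[OF K]] measurable_compose[OF snd_r sphere_cont_measurable[OF F(1)]]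
  have meas: "(\<lambda>(\<theta>, q). ?f \<theta> q) \<in> borel_measurable (?I \<Otimes>\<^sub>M sphere_measure)"
    unfolding split_beta by measurable
  obtain a where a: "\<forall>x\<in>hsphere. \<bar>K x\<bar> \<le> a" using sphere_cont_bounded[OF K] by blast
  obtain b where b: "\<forall>x\<in>hsphere. \<bar>F x\<bar> \<le> b" using sphere_cont_bounded[OF F(1)] by blast
  have "integrable (?I \<Otimes>\<^sub>M sphere_measure) (\<lambda>(\<theta>, q). ?f \<theta> q)"
  proof (rule IS.integrable_const_bound[OF AE_I2 meas])
    fix x :: "real \<times> 'n hvec" assume "x \<in> space (?I \<Otimes>\<^sub>M sphere_measure)"
    then have x: "norm (snd x) = 1" by (auto simp: space_pair_measure)
    have "\<bar>K (qact (cis (fst x), 0) (snd x))\<bar> \<le> a" "\<bar>F (snd x)\<bar> \<le> b"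
      using a b x norm_qact_cis[of "fst x" "snd x"] by simp_all
    then show "norm (case x of (\<theta>, q) \<Rightarrow> ?f \<theta> q) \<le> a * b"
      unfolding split_beta real_norm_def abs_mult by (intro mult_mono) auto
  qed
  from Fubini_integral[OF this]
  have "(\<integral>q. \<integral>\<theta>. ?f \<theta> q \<partial>?I \<partial>sphere_measure) = (\<integral>\<theta>. \<integral>q. ?f \<theta> q \<partial>sphere_measure \<partial>?I)"
    by (simp add: split_beta)
  moreover have "(\<integral>q. ?f \<theta> q \<partial>sphere_measure) = (\<integral>q. K q * F q \<partial>sphere_measure)" for \<theta>
  proof -
    have "(\<lambda>q. K q * F q) \<in> sphere_cont"
      using K F by (auto simp: sphere_cont_def intro!: continuous_intros)
    from integral_sphere_qact_cis[OF this, of \<theta>]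
    have "(\<integral>q. K (qact (cis \<theta>, 0) q) * F (qact (cis \<theta>, 0) q) \<partial>sphere_measure) = (\<integral>q. K q * F q \<partial>sphere_measure)" .
    moreover have "(\<integral>q. ?f \<theta> q \<partial>sphere_measure) = (\<integral>q. K (qact (cis \<theta>, 0) q) * F (qact (cis \<theta>, 0) q) \<partial>sphere_measure)"
      using F(2) by (intro Bochner_Integration.integral_cong) (auto simp: circle_invariant_def)
    ultimately show ?thesis by simp
  qed
  moreover have "(\<integral>\<theta>. ?f \<theta> q \<partial>?I) = 2 * pi * (circle_avg K q * F q)" if "norm q = 1" for q
  proof -
    have Kc: "continuous_on hsphere K" using K by (simp add: sphere_cont_def)
    have "set_integrable lborel {0..2 * pi} (\<lambda>\<theta>. K (qact (cis \<theta>, 0) q))"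
      by (rule borel_integrable_atLeastAtMost') (rule continuous_on_orbit[OF Kc that])
    from set_borel_integral_eq_integral(2)[OF this]
    have "(\<integral>\<theta>. K (qact (cis \<theta>, 0) q) \<partial>?I) = integral {0..2 * pi} (\<lambda>\<theta>. K (qact (cis \<theta>, 0) q))"
      by (subst integral_restrict_space) (auto simp: set_lebesgue_integral_def)
    then show ?thesis by (simp add: circle_avg_def)
  qed
  moreover have "(\<integral>q. \<integral>\<theta>. ?f \<theta> q \<partial>?I \<partial>sphere_measure) = (\<integral>q. 2 * pi * (circle_avg K q * F q) \<partial>sphere_measure)"
    by (rule Bochner_Integration.integral_cong) (use calculation(3) in auto)
  moreover have "measure ?I (space ?I) = 2 * pi"
    by (simp add: space_restrict_space measure_restrict_space)
  ultimately show ?thesis by simp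
qed

text \<open>A vanishing square integral gives zero almost everywhere. By continuity a nonzero value
  would persist on an open part of a cone, hence on a ball of positive Lebesgue measure.\<close>

lemma sphere_integral_square_zero:
  fixes G :: "'n::finite hvec \<Rightarrow> real"
  assumes G: "G \<in> sphere_cont" and zero: "(\<integral>q. G q * G q \<partial>sphere_measure) = 0" and q: "norm q = 1"
  shows "G q = 0"
proof (rule ccontr)
  assume nz: "G q \<noteq> 0"
  have GG: "(\<lambda>q. G q * G q) \<in> sphere_cont"
    using G by (auto simp: sphere_cont_def intro!: continuous_intros)
  let ?A = "{x \<in> hsphere. G x \<noteq> 0}"
  have "AE x in sphere_measure. G x * G x = 0"
    using zero by (subst (asm) integral_nonneg_eq_0_iff_AE[OF sphere_cont_integrable[OF GG]]) auto
  then have ae: "AE x in sphere_measure. \<not> (G x \<noteq> 0)" by eventually_elim simp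
  have "?A = G -` (- {0}) \<inter> space (restrict_space borel hsphere)" by (auto simp: space_restrict_space)
  also have "\<dots> \<in> sets (restrict_space borel hsphere)"
    by (rule measurable_sets[OF sphere_cont_measurable[OF G]]) auto
  finally have A: "?A \<in> sets (restrict_space borel hsphere)" .
  have zeroD: "a \<noteq> 0 \<Longrightarrow> a * b = 0 \<Longrightarrow> b = 0" for a b :: ennreal by simp
  have "emeasure sphere_measure ?A = 0"
    using AE_iff_measurable[of ?A sphere_measure "\<lambda>x. \<not> (G x \<noteq> 0)"] ae A by simp
  then have null: "emeasure lborel (sgn -` ?A \<inter> (cball 0 1 - {0})) = 0"
    unfolding emeasure_sphere_measure[OF A] by (rule zeroD[rotated]) simp
  define U where "U = (ball 0 1 - {0}) \<inter> (\<lambda>x. G (sgn x)) -` (- {0})"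
  have "continuous_on (ball 0 1 - {0}) (\<lambda>x. G (sgn x))"
  proof (rule continuous_on_compose2[of hsphere G])
    show "continuous_on (ball 0 1 - {0}) (sgn :: 'n hvec \<Rightarrow> _)"
      unfolding sgn_div_norm[abs_def] by (intro continuous_intros) auto
    show "sgn ` (ball 0 1 - {0}) \<subseteq> (hsphere :: 'n hvec set)"
      by (rule image_subsetI) (simp add: norm_sgn)
  qed (use G in \<open>simp add: sphere_cont_def\<close>)
  then have "open U" unfolding U_def by (intro continuous_open_preimage) auto
  \<comment> \<open>The point is halved because \<open>q\<close> itself lies on the boundary of the
    unit ball, while \<open>U\<close> is a subset of the open ball.\<close>
  moreover have "(1 / 2) *\<^sub>R q \<in> U" using q nz by (simp add: U_def sgn_scaleR) (auto simp: sgn_div_norm)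
  ultimately obtain d where d: "d > 0" "ball ((1 / 2) *\<^sub>R q) d \<subseteq> U" using openE by blast
  have "U \<subseteq> sgn -` ?A \<inter> (cball 0 1 - {0})" by (auto simp: U_def norm_sgn)
  with d have sub: "ball ((1 / 2) *\<^sub>R q) d \<subseteq> sgn -` ?A \<inter> (cball 0 1 - {0})" by blast
  have "sgn -` ?A \<inter> (cball 0 1 - {0}) \<in> sets borel"
    using measurable_sets[OF sgn_measurable A]
    by (subst (asm) sets_restrict_space_iff) (auto simp: space_restrict_space)
  then have "emeasure lborel (ball ((1 / 2) *\<^sub>R q) d) \<le> 0"
    unfolding null[symmetric] by (intro emeasure_mono[OF sub]) simp
  then have "emeasure lborel (ball ((1 / 2) *\<^sub>R q) d) = 0" by simp
  then show False using d(1) unit_ball_vol_pos[of "real DIM('n hvec)"]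
    by (simp add: emeasure_ball del: DIM_prod)
qed


section \<open>The heat kernels\<close>

lemma integral_scale_measure:
  fixes f :: "'a \<Rightarrow> real"
  assumes "c \<ge> 0" "f \<in> borel_measurable M"
  shows "(\<integral>x. f x \<partial>scale_measure (ennreal c) M) = c * (\<integral>x. f x \<partial>M)"
proof -
  have "scale_measure (ennreal c) M = density M (\<lambda>_. ennreal c)"
    by (rule measure_eqI) (simp_all add: emeasure_density nn_integral_cmult_indicator)
  then show ?thesis using assms by (simp add: integral_density)
qed

section \<open>Integration on the projective space\<close>

lemma CP_sigma_generator: "{A. A \<subseteq> CPspace \<and> cproj -` A \<inter> hsphere \<in> sets (restrict_space borel hsphere)} \<subseteq> Pow CPspace"
  by blast

lemma space_CP_sigma [simp]: "space CP_sigma = CPspace"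
  unfolding CP_sigma_def by (rule space_measure_of[OF CP_sigma_generator])

lemma cproj_measurable: "cproj \<in> sphere_measure \<rightarrow>\<^sub>M CP_sigma"
  unfolding CP_sigma_def
  by (rule measurable_measure_of[OF CP_sigma_generator]) (auto simp: CPspace_def)

lemma CP_cont_measurable: "H \<in> CP_cont \<Longrightarrow> H \<in> borel_measurable CP_sigma"
proof (rule measurableI)
  fix B :: "real set" assume H: "H \<in> CP_cont" and B: "B \<in> sets borel"
  have "cproj -` (H -` B \<inter> CPspace) \<inter> hsphere = (H \<circ> cproj) -` B \<inter> space (restrict_space borel hsphere)"
    by (auto simp: CPspace_def space_restrict_space)
  also have "\<dots> \<in> sets (restrict_space borel hsphere)"
    using H by (intro measurable_sets[OF sphere_cont_measurable B]) (simp add: CP_cont_def)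
  finally have "H -` B \<inter> CPspace \<in> {A. A \<subseteq> CPspace \<and> cproj -` A \<inter> hsphere \<in> sets (restrict_space borel hsphere)}"
    by blast
  then show "H -` B \<inter> space CP_sigma \<in> sets CP_sigma"
    unfolding CP_sigma_def sets_measure_of[OF CP_sigma_generator] space_measure_of[OF CP_sigma_generator]
    by (rule sigma_sets.Basic)
qed simp

lemma integral_CP_measure:
  assumes "f \<in> CP_cont"
  shows "(\<integral>X. f X \<partial>CP_measure) = 1 / (2 * pi) * (\<integral>q. f (cproj q) \<partial>sphere_measure)"
proof -
  have m: "f \<in> borel_measurable CP_sigma" by (rule CP_cont_measurable[OF assms])
  have "(\<integral>X. f X \<partial>CP_measure) = 1 / (2 * pi) * (\<integral>X. f X \<partial>distr sphere_measure CP_sigma cproj)"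
    unfolding CP_measure_def by (rule integral_scale_measure) (use m in simp_all)
  then show ?thesis by (simp only: integral_distr[OF cproj_measurable m])
qed

lemma total_CP_measure:
  "emeasure CP_measure (CPspace :: 'n::finite hvec set set) =
    ennreal (1 / (2 * pi)) * ennreal (real DIM('n hvec) * unit_ball_vol (real DIM('n hvec)))"
proof -
  have "CPspace \<in> sets (CP_sigma :: 'n hvec set measure)" using sets.top[of CP_sigma] by simp
  moreover have "cproj -` CPspace \<inter> hsphere = (hsphere :: 'n hvec set)" by (auto simp: CPspace_def)
  ultimately show ?thesis
    unfolding CP_measure_def emeasure_scale_measure
    by (subst emeasure_distr[OF cproj_measurable]) (simp_all add: total_sphere_measure del: DIM_prod)
qed

text \<open>Junk value: \<open>distr M N f\<close> is the zero measure if \<open>A \<mapsto> emeasure M (f -` A \<inter> space M)\<close> is not a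
  measure, which can happen when \<open>f\<close> is not measurable.\<close>

lemma emeasure_distr_space:
  assumes "f \<in> space M \<rightarrow> space N"
  shows "emeasure (distr M N f) (space N) \<in> {0, emeasure M (space M)}"
proof -
  have "f -` space N \<inter> space M = space M" using assms by auto
  then show ?thesis unfolding distr_def emeasure_measure_of_conv by auto
qed

text \<open>The density is a product, so Tonelli separates the variables. The angular factor
  integrates to 1. In the radial one \<open>cos r ^ 3\<close> is
  \<open>cos r * (1 - (sin r)\<^sup>2)\<close>, which leaves \<open>1 / m - 1 / (m + 2)\<close>. The
  application has \<open>m = 4 * CARD('n)\<close>.\<close>

lemma total_reference_density:
  fixes C :: real and m :: nat
  assumes C: "C > 0" and m: "m > 0"
  shows "emeasure (density lborel (\<lambda>(r, \<phi>). indicator ({0..pi/2} \<times> {0..pi/2}) (r, \<phi>) *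
         ennreal (C * sin r ^ (m - 1) * cos r ^ 3 * sin (2 * \<phi>)))) UNIV = ennreal (C * 2 / (real m * (real m + 2)))"
    (is "emeasure (density lborel ?w) UNIV = _")
proof -
  define u where "u r = C * sin r ^ (m - 1) * cos r ^ 3" for r :: real
  have u_nonneg: "u r \<ge> 0" if "0 \<le> r" "r \<le> pi / 2" for r
    unfolding u_def using C that by (intro mult_nonneg_nonneg zero_le_power sin_ge_zero cos_ge_zero) auto
  have [measurable]: "u \<in> borel_measurable borel" unfolding u_def[abs_def] by measurable
  have w: "?w (r, \<phi>) = (ennreal (u r) * indicator {0..pi/2} r) * (ennreal (sin (2 * \<phi>)) * indicator {0..pi/2} \<phi>)" for r \<phi>
    unfolding prod.case u_def[symmetric] using u_nonneg[of r] by (auto simp: indicator_def ennreal_mult')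
  have wm: "?w \<in> borel_measurable (lborel \<Otimes>\<^sub>M lborel)"
    unfolding split_beta by measurable
  have "emeasure (density lborel ?w) UNIV = (\<integral>\<^sup>+ x. ?w x \<partial>(lborel \<Otimes>\<^sub>M lborel))"
    using wm by (subst emeasure_density) (simp_all add: lborel_prod)
  also have "\<dots> = (\<integral>\<^sup>+ r. \<integral>\<^sup>+ \<phi>. ?w (r, \<phi>) \<partial>lborel \<partial>lborel)"
    by (rule lborel.nn_integral_fst[OF wm, symmetric])
  also have "\<dots> = (\<integral>\<^sup>+ r. (ennreal (u r) * indicator {0..pi/2} r) * (\<integral>\<^sup>+ \<phi>. ennreal (sin (2 * \<phi>)) * indicator {0..pi/2} \<phi> \<partial>lborel) \<partial>lborel)"
    unfolding w by (subst nn_integral_cmult) simp_all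
  also have "(\<integral>\<^sup>+ \<phi>. ennreal (sin (2 * \<phi>)) * indicator {0..pi/2} \<phi> \<partial>lborel) = ennreal (- cos (2 * (pi / 2)) / 2 - (- cos (2 * 0) / 2))"
    by (rule nn_integral_FTC_Icc) (auto intro!: derivative_eq_intros sin_ge_zero)
  also have "\<dots> = 1" by simp
  also have "(\<integral>\<^sup>+ r. (ennreal (u r) * indicator {0..pi/2} r) * 1 \<partial>lborel) = (\<integral>\<^sup>+ r. ennreal (u r) * indicator {0..pi/2} r \<partial>lborel)"
    by simp
  also have "\<dots> = ennreal (C * (sin (pi/2) ^ m / real m - sin (pi/2) ^ (m + 2) / real (m + 2))
        - C * (sin 0 ^ m / real m - sin 0 ^ (m + 2) / real (m + 2)))"
  proof (rule nn_integral_FTC_Icc)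
    fix r :: real
    have d: "((\<lambda>r. sin r ^ k / real k) has_field_derivative sin r ^ (k - 1) * cos r) (at r)" if "k > 0" for k
      using that by (auto intro!: derivative_eq_intros)
    have "sin r ^ (m + 2 - 1) = sin r ^ (m - 1) * (sin r)\<^sup>2"
      using m by (simp add: power_add[symmetric])
    then have "C * (sin r ^ (m - 1) * cos r - sin r ^ (m + 2 - 1) * cos r) = C * sin r ^ (m - 1) * cos r * (1 - (sin r)\<^sup>2)"
      by (simp only: algebra_simps)
    also have "\<dots> = u r"
      unfolding u_def cos_squared_eq[symmetric] by (simp add: power2_eq_square power3_eq_cube mult_ac)
    finally show "((\<lambda>r. C * (sin r ^ m / real m - sin r ^ (m + 2) / real (m + 2))) has_field_derivative u r) (at r)"
      using DERIV_cmult[OF DERIV_diff[OF d[OF m] d[of "m + 2"]], of C] by simp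
  qed (use u_nonneg in auto)
  also have "C * (sin (pi/2) ^ m / real m - sin (pi/2) ^ (m + 2) / real (m + 2))
        - C * (sin 0 ^ m / real m - sin 0 ^ (m + 2) / real (m + 2)) = C * 2 / (real m * (real m + 2))"
    using m by (simp add: field_simps)
  finally show ?thesis .
qed

text \<open>The ball volume in dimension \<open>4 * n + 4\<close> contains Gamma at
  \<open>2 * n + 3\<close>; three steps of the functional equation bring it down to
  \<open>2 * n\<close>, the argument in the reference density.\<close>

lemma sphere_volume:
  "real DIM('n::finite hvec) * unit_ball_vol (real DIM('n hvec)) =
    2 * pi ^ (2 * CARD('n) + 2) / (Gamma (2 * real CARD('n)) * (2 * real CARD('n) * (2 * real CARD('n) + 1)))"
proof -
  define n where "n = real CARD('n)"
  have n: "n > 0" by (simp add: n_def)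
  have dim: "real DIM('n hvec) = 4 * n + 4" by (simp add: n_def)
  have Gm: "Gamma (2 * n + 1 + 1 + 1) = (2 * n + 2) * ((2 * n + 1) * (2 * n * Gamma (2 * n)))"
    using n Gamma_plus1[of "2 * n"] Gamma_plus1[of "2 * n + 1"] Gamma_plus1[of "2 * n + 1 + 1"]
    by (simp add: nonpos_Ints_def add.assoc)
  have pw: "pi powr (2 * n + 2) = pi ^ (2 * CARD('n) + 2)"
    using powr_realpow[of pi "2 * CARD('n) + 2"] by (simp add: n_def add.commute)
  have eq: "(4 * n + 4) / 2 = 2 * n + 2" "2 * n + 2 + 1 = 2 * n + 1 + 1 + 1" "4 * n + 4 = 2 * (2 * n + 2)"
    by simp_all
  have V: "unit_ball_vol (4 * n + 4) = pi ^ (2 * CARD('n) + 2) / ((2 * n + 2) * ((2 * n + 1) * (2 * n * Gamma (2 * n))))"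
    by (simp only: unit_ball_vol_def eq(1) pw eq(2) Gm)
  have cancel: "2 * a * (X / (a * (b * (d * g)))) = 2 * X / (g * (d * b))" if "a \<noteq> 0" for a b d g X :: real
    using that by (simp add: mult_ac)
  show ?thesis
    unfolding dim V n_def[symmetric] unfolding eq(3) by (rule cancel) (use n in simp)
qed

text \<open>The measures are known to be proportional, so total masses decide. The coordinates pass
  through the choice function \<open>rep\<close>; instead of proving them measurable, the image
  measure is seen to have mass 0 or the full mass, and 0 is excluded by the density. The reference
  mass is \<open>2 * Y\<close> and that of \<open>CP_measure\<close> is \<open>Y / (2 * pi)\<close>,
  with \<open>Y\<close> the area of the sphere.\<close>

lemma reference_constant:
  fixes \<nu> :: "'n::finite hvec set measure"
  assumes "CP_reference_measure \<nu>"
  shows "\<nu> = scale_measure (ennreal (4 * pi)) CP_measure"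
proof -
  obtain c where c: "c > 0" "\<nu> = scale_measure (ennreal c) CP_measure"
    using assms unfolding CP_reference_measure_def by blast
  define n where "n = real CARD('n)"
  have n: "n > 0" by (simp add: n_def)
  have G: "Gamma (2 * n) > 0" using n by simp
  define C where "C = 8 * pi ^ (2 * CARD('n) + 2) / Gamma (2 * n)"
  have C: "C > 0" using G by (simp add: C_def)
  let ?h = "\<lambda>X :: 'n hvec set. (coord_r (rep X), coord_phi (rep X))"
  have "emeasure (distr \<nu> borel ?h) UNIV = ennreal (C * 2 / (real (4 * CARD('n)) * (real (4 * CARD('n)) + 2)))"
    using assms total_reference_density[OF C, of "4 * CARD('n)"]
    unfolding CP_reference_measure_def C_def n_def by simp
  moreover have "emeasure (distr \<nu> borel ?h) UNIV \<in> {0, emeasure \<nu> (space \<nu>)}"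
    using emeasure_distr_space[of ?h \<nu> borel] by simp
  moreover have pos: "C * 2 / (real (4 * CARD('n)) * (real (4 * CARD('n)) + 2)) > 0"
    using C by simp
  ultimately have "emeasure \<nu> (space \<nu>) = ennreal (C * 2 / (real (4 * CARD('n)) * (real (4 * CARD('n)) + 2)))"
    by (auto simp: ennreal_eq_0_iff)
  moreover have "space \<nu> = CPspace"
    by (simp add: c(2) space_scale_measure CP_measure_def)
  then have "emeasure \<nu> (space \<nu>) = ennreal (c / (2 * pi) * (real DIM('n hvec) * unit_ball_vol (real DIM('n hvec))))"
    using c(1) by (simp only: c(2) emeasure_scale_measure total_CP_measure)
      (simp add: ennreal_mult'[symmetric] mult.assoc[symmetric] del: DIM_prod)
  ultimately have "c / (2 * pi) * (real DIM('n hvec) * unit_ball_vol (real DIM('n hvec)))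
      = C * 2 / (real (4 * CARD('n)) * (real (4 * CARD('n)) + 2))"
    using c(1) pos by (simp del: DIM_prod)
  moreover define Y where "Y = 2 * pi ^ (2 * CARD('n) + 2) / (Gamma (2 * n) * (2 * n * (2 * n + 1)))"
  moreover have "C * 2 / (4 * n * (4 * n + 2)) = 2 * Y"
  proof -
    have D: "4 * n * (4 * n + 2) = 2 * (2 * (2 * n * (2 * n + 1)))" by (simp add: algebra_simps)
    have "8 * X / g * 2 / (2 * (2 * d)) = 2 * (2 * X / (g * d))" for X g d :: real by simp
    then show ?thesis unfolding C_def Y_def D .
  qed
  ultimately have "c / (2 * pi) * Y = 2 * Y"
    unfolding sphere_volume n_def by simp
  moreover have "Y > 0" using n G by (simp add: Y_def)
  then have "Y \<noteq> 0" by simp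
  ultimately have "c / (2 * pi) = 2" by (metis mult_right_cancel)
  then have "c = 4 * pi" by (simp add: field_simps)
  then show ?thesis by (simp add: c(2))
qed

text \<open>The difference \<open>G\<close> of the two sides is continuous and invariant, so it
  descends to an admissible test function. Testing both kernels against it shows that the integral
  of its square vanishes. The factor 2 is \<open>4 * pi\<close>, from the reference measure, divided
  by the fibre length \<open>2 * pi\<close>.\<close>

lemma heat_kernels_circle_avg:
  fixes K :: "real \<Rightarrow> 'n::finite hvec \<Rightarrow> real"
  assumes P: "heat_semigroup hsphere sphere_cont sphere_smooth sphere_subLaplacian P"
    and K: "heat_kernel_from sphere_measure sphere_cont P north K"
    and Q: "heat_semigroup CPspace CP_cont CP_smooth CP_subLaplacian Q"
    and \<nu>: "CP_reference_measure \<nu>"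
    and H: "heat_kernel_from \<nu> CP_cont Q (cproj north) H"
    and t: "t > 0" and q: "norm q = 1"
  shows "2 * H t (cproj q) = circle_avg (K t) q"
proof -
  have Kt: "K t \<in> sphere_cont" and PK: "\<And>f. f \<in> sphere_cont \<Longrightarrow> P t f north = (\<integral>x. K t x * f x \<partial>sphere_measure)"
    using K t unfolding heat_kernel_from_def by blast+
  have Ht: "H t \<in> CP_cont" and QH: "\<And>f. f \<in> CP_cont \<Longrightarrow> Q t f (cproj north) = (\<integral>x. H t x * f x \<partial>\<nu>)"
    using H t unfolding heat_kernel_from_def by blast+
  define G where "G q = 2 * H t (cproj q) - circle_avg (K t) q" for q
  have Kc: "continuous_on hsphere (K t)" using Kt by (simp add: sphere_cont_def)
  have Hc: "continuous_on hsphere (\<lambda>q. H t (cproj q))" using Ht by (simp add: CP_cont_def sphere_cont_def o_def)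
  have Gc: "continuous_on hsphere G"
    unfolding G_def[abs_def] by (intro continuous_intros Hc continuous_on_circle_avg Kc)
  have Gi: "circle_invariant G"
    using circle_avg_invariant[OF Kc] by (simp add: G_def circle_invariant_def cproj_qact_cis)
  define f where "f X = G (rep X)" for X
  have fG: "f (cproj q) = G q" if "norm q = 1" for q
    unfolding f_def by (rule invariant_rep_cproj[OF Gi that])
  have "continuous_on hsphere (f \<circ> cproj)"
    by (rule continuous_on_eq[OF Gc]) (simp add: fG)
  then have fC: "f \<in> CP_cont" by (simp add: CP_cont_def sphere_cont_def)
  have HfC: "(\<lambda>X. H t X * f X) \<in> CP_cont"
    using Ht fC by (auto simp: CP_cont_def sphere_cont_def o_def intro!: continuous_intros)
  have "norm (north :: 'n hvec) = 1" by (simp add: north_def norm_prod_def)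
  from semigroups_agree[OF P Q fC this, of t] t
  have "Q t f (cproj north) = P t (f \<circ> cproj) north" by simp
  moreover have "Q t f (cproj north) = (\<integral>q. 2 * H t (cproj q) * G q \<partial>sphere_measure)"
  proof -
    have "(\<integral>X. H t X * f X \<partial>\<nu>) = 4 * pi * (\<integral>X. H t X * f X \<partial>CP_measure)"
      unfolding reference_constant[OF \<nu>]
      by (rule integral_scale_measure) (use CP_cont_measurable[OF HfC] in \<open>simp_all add: CP_measure_def\<close>)
    also have "\<dots> = 2 * (\<integral>q. H t (cproj q) * f (cproj q) \<partial>sphere_measure)"
      unfolding integral_CP_measure[OF HfC] by simp
    also have "\<dots> = (\<integral>q. 2 * H t (cproj q) * G q \<partial>sphere_measure)"
      unfolding integral_mult_right_zero[symmetric]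
      by (rule Bochner_Integration.integral_cong) (simp_all add: fG)
    finally show ?thesis using QH[OF fC] by simp
  qed
  moreover have "P t (f \<circ> cproj) north = (\<integral>q. circle_avg (K t) q * G q \<partial>sphere_measure)"
  proof -
    have "f \<circ> cproj \<in> sphere_cont" using fC by (simp add: CP_cont_def)
    then have "P t (f \<circ> cproj) north = (\<integral>q. K t q * (f \<circ> cproj) q \<partial>sphere_measure)" by (rule PK)
    also have "\<dots> = (\<integral>q. K t q * G q \<partial>sphere_measure)"
      by (rule Bochner_Integration.integral_cong) (simp_all add: fG)
    also have "\<dots> = (\<integral>q. circle_avg (K t) q * G q \<partial>sphere_measure)"
      by (rule integral_circle_avg[OF Kt _ Gi]) (simp add: sphere_cont_def Gc)
    finally show ?thesis .
  qed
  moreover have "integrable sphere_measure (\<lambda>q. 2 * H t (cproj q) * G q)"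
    by (rule sphere_cont_integrable) (use Hc Gc in \<open>auto simp: sphere_cont_def intro!: continuous_intros\<close>)
  moreover have "integrable sphere_measure (\<lambda>q. circle_avg (K t) q * G q)"
    by (rule sphere_cont_integrable)
       (use Gc continuous_on_circle_avg[OF Kc] in \<open>auto simp: sphere_cont_def intro!: continuous_intros\<close>)
  ultimately have "(\<integral>q. 2 * H t (cproj q) * G q - circle_avg (K t) q * G q \<partial>sphere_measure) = 0"
    by (simp add: Bochner_Integration.integral_diff)
  then have "(\<integral>q. G q * G q \<partial>sphere_measure) = 0"
    by (simp add: G_def left_diff_distrib)
  from sphere_integral_square_zero[OF _ this q] Gc show ?thesis
    by (simp add: sphere_cont_def G_def)
qed

section \<open>The formula in cylindrical coordinates\<close>

lemma integral_double_cos: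
  fixes F :: "real \<Rightarrow> real"
  assumes "(\<lambda>\<theta>. F (cos \<theta>)) integrable_on {0..2 * pi}"
  shows "integral {0..2 * pi} (\<lambda>\<theta>. F (cos \<theta>)) = 2 * integral {0..pi} (\<lambda>\<theta>. F (cos \<theta>))"
proof -
  have "(\<lambda>\<theta>. F (cos \<theta>)) integrable_on {pi..2 * pi}"
    using assms by (rule integrable_on_subinterval) auto
  then have "((\<lambda>\<theta>. F (cos \<theta>)) has_integral integral {pi..2 * pi} (\<lambda>\<theta>. F (cos \<theta>))) (cbox pi (2 * pi))"
    by (simp add: has_integral_integral)
  from has_integral_affinity[OF this, of "-1" "2 * pi"]
  have "((\<lambda>\<theta>. F (cos \<theta>)) has_integral integral {pi..2 * pi} (\<lambda>\<theta>. F (cos \<theta>))) ((\<lambda>x. 2 * pi - x) ` {pi..2 * pi})"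
    by (simp add: cos_diff)
  moreover have "(\<lambda>x. 2 * pi - x) ` {pi..2 * pi} = {0..pi}"
    by (simp add: image_diff_atLeastAtMost)
  ultimately have "integral {0..pi} (\<lambda>\<theta>. F (cos \<theta>)) = integral {pi..2 * pi} (\<lambda>\<theta>. F (cos \<theta>))"
    by (simp add: integral_unique)
  then show ?thesis
    using Henstock_Kurzweil_Integration.integral_combine[of 0 pi "2 * pi", OF _ _ assms] by simp
qed

theorem proposition3p2:
  fixes P :: "real \<Rightarrow> ('n::finite hvec \<Rightarrow> real) \<Rightarrow> 'n hvec \<Rightarrow> real"
    and Q :: "real \<Rightarrow> ('n hvec set \<Rightarrow> real) \<Rightarrow> 'n hvec set \<Rightarrow> real"
    and K :: "real \<Rightarrow> 'n hvec \<Rightarrow> real"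
    and H :: "real \<Rightarrow> 'n hvec set \<Rightarrow> real"
    and p h :: "real \<Rightarrow> real \<Rightarrow> real \<Rightarrow> real"
    and \<nu> :: "'n hvec set measure"
    and t r \<phi> :: real
  assumes "heat_semigroup hsphere sphere_cont sphere_smooth sphere_subLaplacian P"
    and "heat_kernel_from sphere_measure sphere_cont P north K"
    and "in_sphere_coords K p"
    and "heat_semigroup CPspace CP_cont CP_smooth CP_subLaplacian Q"
    and "CP_reference_measure \<nu>"
    and "heat_kernel_from \<nu> CP_cont Q (cproj north) H"
    and "in_CP_coords H h"
    and "t > 0" and "0 \<le> r" "r < pi / 2" and "0 \<le> \<phi>" "\<phi> \<le> pi / 2"
  shows "h t r \<phi> = 1 / (2 * pi) * integral {0..pi} (\<lambda>\<theta>. p t r (arccos (cos \<phi> * cos \<theta>)))"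
proof -
  \<comment> \<open>The last coordinate is \<open>cos r * (cos \<phi> + sin \<phi> J)\<close>.
    Multiplication by the circle element of angle \<open>\<theta>\<close> keeps its norm and gives
    it the real part \<open>cos r * cos \<phi> * cos \<theta>\<close>, which is the origin of the
    \<open>arccos\<close> in the formula.\<close>
  define w :: quat where "w = (of_real (cos r * cos \<phi>), of_real (cos r * sin \<phi>))"
  \<comment> \<open>The missing length \<open>sin r\<close> is put into one of the first
    coordinates; \<open>undefined\<close> is merely some index.\<close>
  define q :: "'n hvec" where "q = (axis undefined (of_real (sin r), 0), w)"
  have cr: "cos r > 0" using assms(9,10) by (intro cos_gt_zero_pi) auto
  have sr: "sin r \<ge> 0" and c\<phi>: "cos \<phi> \<ge> 0"
    using assms(9-12) by (auto intro!: sin_ge_zero cos_ge_zero)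
  have "(norm w)\<^sup>2 = (cos r)\<^sup>2 * ((cos \<phi>)\<^sup>2 + (sin \<phi>)\<^sup>2)"
    by (simp add: w_def norm_prod_def norm_mult power_mult_distrib distrib_left del: sin_cos_squared_add2)
  then have nw: "norm w = cos r"
    using cr by (simp add: power2_eq_iff_nonneg)
  have "complex_of_real (sin r) \<bullet> complex_of_real (sin r) = (sin r)\<^sup>2"
    by (simp add: inner_complex_def power2_eq_square)
  then have "q \<bullet> q = (sin r)\<^sup>2 + (norm w)\<^sup>2"
    by (simp add: q_def inner_prod_def inner_axis_axis power2_norm_eq_inner)
  then have nq: "norm q = 1" by (simp add: norm_eq_1 nw)
  have wnz: "w \<noteq> 0" using nw cr by auto
  have snd_g: "snd (qact (cis \<theta>, 0) q) = qmult (cis \<theta>, 0) w" for \<theta>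
    by (simp add: qact_def q_def)
  have ng: "norm (qmult (cis \<theta>, 0) w) = cos r" for \<theta>
    using qmult_inner[of "(cis \<theta>, 0)" w w] nw
    by (simp add: norm_eq_sqrt_inner[of "qmult _ _"] norm_cis_pair norm_eq_sqrt_inner[of w] del: norm_prod_def)
  have re: "Re (fst (qmult (cis \<theta>, 0) w)) = cos r * (cos \<phi> * cos \<theta>)" for \<theta>
    by (simp add: qmult_def w_def)
  have Kp: "K t (qact (cis \<theta>, 0) q) = p t r (arccos (cos \<phi> * cos \<theta>))" for \<theta>
  proof -
    have "snd (qact (cis \<theta>, 0) q) \<noteq> 0" using ng[of \<theta>] cr by (auto simp: snd_g)
    then have "K t (qact (cis \<theta>, 0) q) = p t (coord_r (qact (cis \<theta>, 0) q)) (coord_eta (qact (cis \<theta>, 0) q))"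
      using assms(3,8) nq norm_qact_cis[of \<theta> q] unfolding in_sphere_coords_def by simp
    then show ?thesis
      using cr assms(9,10) by (simp add: coord_r_def coord_eta_def snd_g ng re arccos_cos)
  qed
  have "H t (cproj q) = h t (coord_r q) (coord_phi q)"
    using assms(7,8) nq wnz unfolding in_CP_coords_def by (simp add: q_def)
  also have "coord_r q = r" using assms(9,10) by (simp add: coord_r_def q_def nw arccos_cos)
  also have "coord_phi q = \<phi>"
  proof -
    have "norm (fst w) / norm w = cos \<phi>"
      using cr c\<phi> unfolding nw by (simp add: w_def abs_mult del: of_real_mult)
    then show ?thesis using assms(11,12) by (simp add: coord_phi_def q_def arccos_cos)
  qed
  finally have "2 * h t r \<phi> = circle_avg (K t) q"
    using heat_kernels_circle_avg[OF assms(1,2,4,5,6,8) nq] by simp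
  also have "\<dots> = 1 / (2 * pi) * integral {0..2 * pi} (\<lambda>\<theta>. p t r (arccos (cos \<phi> * cos \<theta>)))"
    by (simp add: circle_avg_def Kp)
  \<comment> \<open>The integrand depends on the angle only through its cosine, so both half circles
    contribute equally; this factor 2 cancels the one in \<open>2 * h t r \<phi>\<close>.\<close>
  also have "integral {0..2 * pi} (\<lambda>\<theta>. p t r (arccos (cos \<phi> * cos \<theta>)))
      = 2 * integral {0..pi} (\<lambda>\<theta>. p t r (arccos (cos \<phi> * cos \<theta>)))"
  proof (rule integral_double_cos)
    have "continuous_on hsphere (K t)"
      using assms(2,8) unfolding heat_kernel_from_def sphere_cont_def by blast
    from integrable_orbit[OF this nq, of 0 "2 * pi"]
    show "(\<lambda>\<theta>. p t r (arccos (cos \<phi> * cos \<theta>))) integrable_on {0..2 * pi}" by (simp add: Kp)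
  qed
  finally show ?thesis by simp
qed

end
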